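(* Let $d\ge 3$, $v>0$, $c\in(0,1)$, let $\nu\ge 2$ be an integer and $Z_1\sim N_d(0,I)$. Then $$\Delta_u\left\{E_{Z_1}\!\left[m_H^{\nu}(tZ_1+u,\,v)\right]\right\}^{c/\nu}\le 0\quad\text{for all }u\in\mathbb{R}^d$$ whenever $$0\le t\le\left(\frac{(d+2)(1-c)v}{d\,\nu(\nu-1)}\right)^{1/2}.$$
   Context: $\phi(\cdot,\sigma^2)$ is the density of $N_d(0,\sigma^2I)$. The harmonic prior is $\pi_H(\mu)=\|\mu\|^{-(d-2)}$ and $m_H(w,v)=\int_{\mathbb{R}^d}\phi(w-\mu,v)\|\mu\|^{-(d-2)}\,d\mu$. *)

theory Defs
  imports "HOL-Analysis.Analysis"
begin

definition gauss_dens :: "'a::euclidean_space \<Rightarrow> real \<Rightarrow> real" where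
  "gauss_dens x s2 = (2 * pi * s2) powr (- real DIM('a) / 2) * exp (- (norm x)\<^sup>2 / (2 * s2))"

text \<open>Marginal under the harmonic prior: m_H(w,v) = int phi(w - mu, v) |mu|^{-(d-2)} dmu.\<close>
definition m_H :: "'a::euclidean_space \<Rightarrow> real \<Rightarrow> real" where
  "m_H w v = (\<integral>\<mu>. gauss_dens (w - \<mu>) v * norm \<mu> powr (- (real DIM('a) - 2)) \<partial>lborel)"

definition laplacian :: "('a::euclidean_space \<Rightarrow> real) \<Rightarrow> 'a \<Rightarrow> real" where
  "laplacian f u = (\<Sum>i\<in>Basis. deriv (deriv (\<lambda>s. f (u + s *\<^sub>R i))) 0)"

end

theory Submission
  imports Defs "HOL-Probability.Distributions"
begin

text \<open>
  Put $a = d/2 - 1$ and $\tau = t^2/v$. Writing $\|\mu\|^{-2a}$ as a mixture of Gaussians gives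
  $m_H(w,v) = C \int_0^1 x^{a-1} e^{-x \|w\|^2/2v}\,dx$, hence, with $r = \|u\|^2/2v$,
  \[ E[m_H^\nu(tZ_1+u,v)] = C^\nu \int \rho\,dM_\nu, \qquad
     \rho(x) = (1+\tau x)^{-d/2} e^{-r \lambda(x)}, \quad \lambda(x) = \frac{x}{1+\tau x}, \]
  where $M_\nu$ is the $\nu$-fold convolution of $x^{a-1}dx$ on $(0,1)$. If $E$ is the mean under
  the normalised measure $\rho\,dM_\nu$, the claim reads
  $2r E\lambda^2 - d E\lambda \le (1 - c/\nu)\, 2r (E\lambda)^2$.

  Integrating by parts along the scaling field turns both sides into first moments $A = E x$ and
  nonnegative boundary terms on the face where one coordinate equals 1. The interior part follows
  from $E\lambda \ge A / (1 + \tau E x^2/A)$ and $E x^2/A \le \nu d/(d+2)$, the latter because $\rho$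
  decreases; this is where the bound on $t$ enters. The boundary part follows from
  $E\lambda \le A/(1+\tau A)$ and the fact that the mean of $x$ on the face is at least $A$, which
  holds because $\log \rho$ is convex.
\<close>

subsection \<open>Convolution powers of the measure with density $x^{a-1}$ on $(0,1)$\<close>

text \<open>Write n for \<nu>, g = 1 - c/n, and let Z, A, L, L2 be the unnormalised integrals of 1,
  x, \<lambda>, \<lambda>^2 against \<rho>; b0 and b1 are the mass and first moment of \<rho> on the
  face. The two integrations by parts give Z (r L2 - (a+1) L) = a (n-1) Z A - n Z b1, g L (r L) = g
  L (a n Z + a (n-1) \<tau> A - n (b0 + \<tau> b1)). The claim compares the left sides, with d =
  2(a+1). The right sides are compared term by term: the interior asks for (n-1) A \<le> g n L, the
  boundary for g L (b0 + \<tau> b1) \<le> Z b1, and the middle term of the second line is a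
  nonnegative surplus. Since g n = n - c, the interior demand is A/L - 1 \<le> (1-c)/(n-1), whereas
  the moment estimates supply A/L - 1 \<le> \<tau> n d/(d+2). That the supply meets the demand is
  exactly the hypothesis on t. The boundary comparison holds for every t, already with g =
  1.\<close>

definition pow_measure :: "real \<Rightarrow> real measure" where
  "pow_measure a = density lborel (\<lambda>x. ennreal (indicator {0<..<1} x * x powr (a - 1)))"

text \<open>Every integrand depends only on the sum of the coordinates, so the cube [0,1]^n is
  carried as an unnormalised measure on the line. The Dirac mass at 0 is the unit of
  convolution.\<close>

primrec pow_conv :: "real \<Rightarrow> nat \<Rightarrow> real measure" where
  "pow_conv a 0 = return borel 0"
| "pow_conv a (Suc n) = convolution (pow_measure a) (pow_conv a n)"

section \<open>Finite Borel measures carried by an interval [0, b]\<close>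

definition finite_on :: "real \<Rightarrow> real measure \<Rightarrow> bool" where
  "finite_on b N \<longleftrightarrow> finite_measure N \<and> sets N = sets borel \<and> (AE x in N. 0 \<le> x \<and> x \<le> b)"

lemma finite_onD:
  assumes "finite_on b N"
  shows "finite_measure N" "sets N = sets borel" "AE x in N. 0 \<le> x \<and> x \<le> b"
    "space N = UNIV" "measurable N borel = measurable borel borel"
  using assms sets_eq_imp_space_eq[of N borel] measurable_cong_sets[of N borel borel borel]
  by (auto simp: finite_on_def)

lemma finite_on_integrable:
  fixes f :: "real \<Rightarrow> real"
  assumes N: "finite_on b N" and f: "f \<in> borel_measurable borel"
    and bd: "\<And>x. 0 \<le> x \<Longrightarrow> x \<le> b \<Longrightarrow> \<bar>f x\<bar> \<le> C"
  shows "integrable N f"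
proof -
  interpret finite_measure N by (rule finite_onD[OF N])
  show ?thesis
  proof (rule integrable_const_bound)
    show "AE x in N. norm (f x) \<le> C"
      using finite_onD(3)[OF N] by eventually_elim (auto intro: bd)
  qed (use finite_onD[OF N] f in simp)
qed

lemma continuous_bound_Icc:
  fixes f :: "real \<Rightarrow> real"
  assumes "continuous_on {0..b} f"
  obtains C where "\<And>x. 0 \<le> x \<Longrightarrow> x \<le> b \<Longrightarrow> \<bar>f x\<bar> \<le> C"
proof -
  have "bounded (f ` {0..b})"
    using assms compact_continuous_image compact_imp_bounded by blast
  then obtain C where "\<forall>x\<in>f ` {0..b}. norm x \<le> C" unfolding bounded_iff by blast
  then show ?thesis by (intro that[of C]) auto
qed

text \<open>Continuity is asked only on [0, b], because \<open>x / (1 + \<tau> * x)\<close> has a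
  pole on the negative axis when \<tau> > 0.\<close>

lemma finite_on_integrable_cont:
  fixes f :: "real \<Rightarrow> real"
  assumes N: "finite_on b N" and f: "f \<in> borel_measurable borel" and c: "continuous_on {0..b} f"
  shows "integrable N f"
  using continuous_bound_Icc[OF c] finite_on_integrable[OF N f] by metis

lemma finite_on_pair_integrable:
  fixes h :: "real \<Rightarrow> real \<Rightarrow> real"
  assumes M: "finite_on a M" and N: "finite_on b N"
    and h[measurable]: "case_prod h \<in> borel_measurable (borel \<Otimes>\<^sub>M borel)"
    and bd: "\<And>x y. 0 \<le> x \<Longrightarrow> x \<le> a \<Longrightarrow> 0 \<le> y \<Longrightarrow> y \<le> b \<Longrightarrow> \<bar>h x y\<bar> \<le> C"
  shows "integrable (M \<Otimes>\<^sub>M N) (case_prod h)"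
proof -
  interpret M: finite_measure M by (rule finite_onD[OF M])
  interpret N: finite_measure N by (rule finite_onD[OF N])
  interpret P: pair_sigma_finite M N ..
  interpret MN: finite_measure "M \<Otimes>\<^sub>M N"
    by (intro finite_measure_pair_measure M.finite_measure_axioms N.finite_measure_axioms)
  note [measurable_cong] = finite_onD(2)[OF M] finite_onD(2)[OF N]
  show ?thesis
  proof (rule MN.integrable_const_bound)
    show "AE x in M \<Otimes>\<^sub>M N. norm (case_prod h x) \<le> C"
    proof (rule P.AE_pair_measure)
      show "{x \<in> space (M \<Otimes>\<^sub>M N). norm (case_prod h x) \<le> C} \<in> sets (M \<Otimes>\<^sub>M N)"
        by measurable
      show "AE x in M. AE y in N. norm (case_prod h (x, y)) \<le> C"
        using finite_onD(3)[OF M]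
      proof eventually_elim
        case (elim x)
        show ?case using finite_onD(3)[OF N] by eventually_elim (use elim bd in auto)
      qed
    qed
  qed measurable
qed

lemma finite_on_convolution:
  assumes M: "finite_on a M" and N: "finite_on b N"
  shows "finite_on (a + b) (convolution M N)"
proof -
  interpret M: finite_measure M by (rule finite_onD[OF M])
  interpret N: finite_measure N by (rule finite_onD[OF N])
  interpret P: pair_sigma_finite M N ..
  note [measurable_cong] = finite_onD(2)[OF M] finite_onD(2)[OF N]
  have "AE x in convolution M N. 0 \<le> x \<and> x \<le> a + b"
    unfolding convolution_def
  proof (subst AE_distr_iff)
    show "AE x in M \<Otimes>\<^sub>M N. 0 \<le> (case x of (x, y) \<Rightarrow> x + y) \<and> (case x of (x, y) \<Rightarrow> x + y) \<le> a + b"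
    proof (rule P.AE_pair_measure)
      show "AE x in M. AE y in N. 0 \<le> (case (x, y) of (x, y) \<Rightarrow> x + y) \<and> (case (x, y) of (x, y) \<Rightarrow> x + y) \<le> a + b"
        using finite_onD(3)[OF M]
      proof eventually_elim
        case (elim x)
        show ?case using finite_onD(3)[OF N] by eventually_elim (use elim in auto)
      qed
    qed measurable
  qed measurable
  then show ?thesis
    unfolding finite_on_def
    using convolution_finite[OF finite_onD(1)[OF M] finite_onD(1)[OF N] finite_onD(2)[OF N] finite_onD(2)[OF M]]
    by simp
qed

lemma finite_on_integral_convolution:
  fixes f :: "real \<Rightarrow> real"
  assumes M: "finite_on a M" and N: "finite_on b N" and f[measurable]: "f \<in> borel_measurable borel"
    and c: "continuous_on {0..a + b} f"
  shows "(\<integral>x. f x \<partial>convolution M N) = (\<integral>x. (\<integral>y. f (x + y) \<partial>N) \<partial>M)"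
    and "integrable M (\<lambda>x. \<integral>y. f (x + y) \<partial>N)"
proof -
  interpret M: finite_measure M by (rule finite_onD[OF M])
  interpret N: finite_measure N by (rule finite_onD[OF N])
  interpret P: pair_sigma_finite M N ..
  note [measurable_cong] = finite_onD(2)[OF M] finite_onD(2)[OF N]
  obtain C where C: "\<And>x. 0 \<le> x \<Longrightarrow> x \<le> a + b \<Longrightarrow> \<bar>f x\<bar> \<le> C"
    using continuous_bound_Icc[OF c] by blast
  have i: "integrable (M \<Otimes>\<^sub>M N) (\<lambda>(x, y). f (x + y))"
    by (rule finite_on_pair_integrable[OF M N, where C=C]) (auto intro: C)
  show "(\<integral>x. f x \<partial>convolution M N) = (\<integral>x. (\<integral>y. f (x + y) \<partial>N) \<partial>M)"
    unfolding convolution_def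
    using P.integral_fst'[OF i] by (subst integral_distr) (auto simp: case_prod_beta')
  show "integrable M (\<lambda>x. \<integral>y. f (x + y) \<partial>N)"
    using P.integrable_fst'[OF i] by simp
qed

section \<open>The single coordinate and integration by parts along the scaling field\<close>

lemma pow_integrable:
  assumes a: "a > 0"
  shows "integrable lborel (\<lambda>x. indicator {0<..<1} x * x powr (a - 1) :: real)"
proof -
  have "((\<lambda>x. x powr (a - 1)) has_integral (1 powr a / a - 0 powr a / a)) {0..1::real}"
  \<comment> \<open>For a < 1, as in dimension 3, the integrand is unbounded near 0; only its
    primitive has to be continuous there.\<close>
  proof (rule fundamental_theorem_of_calculus_interior)
    show "continuous_on {0..1} (\<lambda>x. x powr a / a)"
      using a by (intro continuous_intros continuous_on_powr') auto
    show "((\<lambda>x. x powr a / a) has_vector_derivative x powr (a - 1)) (at x)" if "x \<in> {0<..<1}" for x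
      unfolding has_real_derivative_iff_has_vector_derivative[symmetric]
      using that a by (auto intro!: derivative_eq_intros)
  qed simp
  then have "(\<lambda>x. x powr (a - 1)) absolutely_integrable_on {0..1::real}"
    by (intro nonnegative_absolutely_integrable_1) (auto simp: integrable_on_def)
  then have "(\<lambda>x. x powr (a - 1)) absolutely_integrable_on {0<..<1::real}"
    by (rule set_integrable_subset) auto
  then have "integrable lebesgue (\<lambda>x. indicator {0<..<1} x * x powr (a - 1) :: real)"
    by (simp add: set_integrable_def)
  then show ?thesis
    by (subst (asm) integrable_completion) auto
qed

lemma sets_pow_measure [measurable_cong, simp]: "sets (pow_measure a) = sets borel"
  by (simp add: pow_measure_def)

lemma finite_on_pow_measure:
  assumes a: "a > 0" shows "finite_on 1 (pow_measure a)"
proof -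
  have "AE x in pow_measure a. 0 \<le> x \<and> x \<le> 1"
    unfolding pow_measure_def by (subst AE_density) (auto simp: indicator_def split: if_splits)
  moreover have "finite_measure (pow_measure a)"
  proof
    have "emeasure (pow_measure a) (space (pow_measure a)) = (\<integral>\<^sup>+x. ennreal (indicator {0<..<1} x * x powr (a - 1)) \<partial>lborel)"
      unfolding pow_measure_def by (simp add: emeasure_density)
    also have "\<dots> = ennreal (\<integral>x. indicator {0<..<1} x * x powr (a - 1) \<partial>lborel)"
      by (rule nn_integral_eq_integral[OF pow_integrable[OF a]]) (auto simp: indicator_def)
    finally show "emeasure (pow_measure a) (space (pow_measure a)) \<noteq> \<infinity>" by simp
  qed
  ultimately show ?thesis by (simp add: finite_on_def)
qed

lemma integral_pow_measure:
  fixes f :: "real \<Rightarrow> real"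
  assumes [measurable]: "f \<in> borel_measurable borel"
  shows "(\<integral>x. f x \<partial>pow_measure a) = (\<integral>x. indicator {0<..<1} x * x powr (a - 1) * f x \<partial>lborel)"
  unfolding pow_measure_def by (subst integral_density) (auto simp: indicator_def)

text \<open>The derivative of \<open>x powr a * f x\<close> is
  \<open>x powr (a - 1) * (x * f' x + a * f x)\<close>. Since a > 0 the primitive vanishes at 0, so
  the only boundary term sits at 1.\<close>

lemma pow_measure_ibp:
  fixes f f' :: "real \<Rightarrow> real"
  assumes a: "a > 0" and [measurable]: "f \<in> borel_measurable borel" "f' \<in> borel_measurable borel"
    and d: "\<And>x. 0 \<le> x \<Longrightarrow> x \<le> 1 \<Longrightarrow> (f has_real_derivative f' x) (at x)"
    and c: "continuous_on {0..1} f'"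
  shows "(\<integral>x. x * f' x \<partial>pow_measure a) = f 1 - a * (\<integral>x. f x \<partial>pow_measure a)"
proof -
  have cf: "continuous_on {0..1} f"
    by (rule DERIV_continuous_on) (use d in \<open>auto intro: has_field_derivative_at_within\<close>)
  note F = finite_on_pow_measure[OF a]
  have i1: "integrable (pow_measure a) f" by (rule finite_on_integrable_cont[OF F _ cf]) simp
  have i2: "integrable (pow_measure a) (\<lambda>x. x * f' x)"
    by (rule finite_on_integrable_cont[OF F]) (auto intro!: continuous_intros c)
  let ?g = "\<lambda>x. x * f' x + a * f x"
  have i3: "integrable (pow_measure a) ?g" using i1 i2 by simp
  have i4: "integrable lborel (\<lambda>x. indicator {0<..<1} x * x powr (a - 1) * ?g x)"
    using i3 unfolding pow_measure_def by (subst (asm) integrable_density) (auto simp: indicator_def)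
  have "(\<integral>x. ?g x \<partial>pow_measure a) = (\<integral>x. indicator {0<..<1} x * x powr (a - 1) * ?g x \<partial>lborel)"
    by (rule integral_pow_measure) simp
  also have "\<dots> = f 1"
  proof -
    have "((\<lambda>x. indicator {0<..<1} x * x powr (a - 1) * ?g x) has_integral
        (\<integral>x. indicator {0<..<1} x * x powr (a - 1) * ?g x \<partial>lborel)) UNIV"
      by (rule has_integral_integral_lborel[OF i4])
    moreover have "((\<lambda>x. indicator {0<..<1} x * x powr (a - 1) * ?g x) has_integral f 1) UNIV"
    proof -
      have "((\<lambda>x. x powr (a - 1) * ?g x) has_integral (1 powr a * f 1 - 0 powr a * f 0)) {0..1::real}"
      proof (rule fundamental_theorem_of_calculus_interior)
        show "continuous_on {0..1} (\<lambda>x. x powr a * f x)"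
          using a by (intro continuous_intros continuous_on_powr' cf) auto
        show "((\<lambda>x. x powr a * f x) has_vector_derivative x powr (a - 1) * ?g x) (at x)" if "x \<in> {0<..<1}" for x
        proof -
          have "x powr a = x * x powr (a - 1)" using that by (simp add: powr_diff)
          then show ?thesis
            unfolding has_real_derivative_iff_has_vector_derivative[symmetric]
            using that a by (auto intro!: derivative_eq_intros d simp: algebra_simps)
        qed
      qed simp
      then have "((\<lambda>x. x powr (a - 1) * ?g x) has_integral f 1) {0<..<1::real}"
        using has_integral_open_interval[of "\<lambda>x. x powr (a - 1) * ?g x" "f 1" 0 "1::real"] by simp
      then have "((\<lambda>x. if x \<in> {0<..<1} then x powr (a - 1) * ?g x else 0) has_integral f 1) UNIV"
        by (simp only: has_integral_restrict_UNIV)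
      then show ?thesis by (rule has_integral_eq[rotated]) (auto simp: indicator_def)
    qed
    ultimately show ?thesis by (rule has_integral_unique)
  qed
  finally show ?thesis using i1 i2 by simp
qed

lemma finite_on_pow_conv:
  assumes a: "a > 0" shows "finite_on (real n) (pow_conv a n)"
proof (induction n)
  case 0
  then show ?case
    by (auto simp: finite_on_def AE_return intro!: prob_space.finite_measure prob_space_return)
next
  case (Suc n)
  then show ?case using finite_on_convolution[OF finite_on_pow_measure[OF a] Suc] by (simp add: add.commute)
qed

text \<open>On the cube this is the one-coordinate identity summed over all coordinates: the terms
  x_i f'(x_1 + ... + x_n) add up to the left side, and by symmetry the n faces x_i = 1 contribute
  equally. At n = 0 the truncated \<open>n - 1\<close> is harmless because of the factor
  \<open>real n\<close>.\<close>

lemma pow_conv_ibp: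
  fixes f f' :: "real \<Rightarrow> real"
  assumes a: "a > 0" and "f \<in> borel_measurable borel" "f' \<in> borel_measurable borel"
    and "\<And>x. 0 \<le> x \<Longrightarrow> x \<le> real n \<Longrightarrow> (f has_real_derivative f' x) (at x)"
    and "continuous_on {0..real n} f'"
  shows "(\<integral>x. x * f' x \<partial>pow_conv a n) =
    real n * ((\<integral>y. f (1 + y) \<partial>pow_conv a (n - 1)) - a * (\<integral>x. f x \<partial>pow_conv a n))"
  using assms(2-)
\<comment> \<open>The induction hypothesis is applied to the translates of f by a fixed x.\<close>
proof (induction n arbitrary: f f')
  case 0
  then show ?case by (simp add: integral_return)
next
  case (Suc n)
  note [measurable] = Suc.prems(1,2)
  note d = Suc.prems(3) and c = Suc.prems(4)
  let ?M = "pow_measure a" and ?N = "pow_conv a n"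
  note M = finite_on_pow_measure[OF a] and N = finite_on_pow_conv[OF a, of n]
  interpret M: finite_measure ?M by (rule finite_onD[OF M])
  interpret N: finite_measure ?N by (rule finite_onD[OF N])
  interpret P: pair_sigma_finite ?M ?N ..
  note [measurable_cong] = finite_onD(2)[OF N]
  have cf: "continuous_on {0..real (Suc n)} f"
    by (rule DERIV_continuous_on) (use d in \<open>auto intro: has_field_derivative_at_within\<close>)
  obtain C where C: "\<And>x. 0 \<le> x \<Longrightarrow> x \<le> real (Suc n) \<Longrightarrow> \<bar>f' x\<bar> \<le> C"
    using continuous_bound_Icc[OF c] by blast
  obtain D where D: "\<And>x. 0 \<le> x \<Longrightarrow> x \<le> real (Suc n) \<Longrightarrow> \<bar>f x\<bar> \<le> D"
    using continuous_bound_Icc[OF cf] by blast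
  have C0: "C \<ge> 0" using C[of 0] by simp
  have ix: "integrable (?M \<Otimes>\<^sub>M ?N) (\<lambda>(x,y). x * f' (x + y))"
  proof (rule finite_on_pair_integrable[OF M N, where C=C])
    fix x y :: real assume "0 \<le> x" "x \<le> 1" "0 \<le> y" "y \<le> real n"
    then show "\<bar>x * f' (x + y)\<bar> \<le> C"
      using mult_mono[of x 1 "\<bar>f' (x + y)\<bar>" C] C[of "x+y"] by (simp add: abs_mult)
  qed measurable
  have iy: "integrable (?M \<Otimes>\<^sub>M ?N) (\<lambda>(x,y). y * f' (x + y))"
  proof (rule finite_on_pair_integrable[OF M N, where C="real n * C"])
    fix x y :: real assume "0 \<le> x" "x \<le> 1" "0 \<le> y" "y \<le> real n"
    then show "\<bar>y * f' (x + y)\<bar> \<le> real n * C"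
      using mult_mono[of y "real n" "\<bar>f' (x + y)\<bar>" C] C[of "x+y"] by (simp add: abs_mult)
  qed measurable
  have iz: "integrable (?M \<Otimes>\<^sub>M ?N) (\<lambda>(x,y). f (x + y))"
    by (rule finite_on_pair_integrable[OF M N, where C=D]) (auto intro!: D)
  have ig: "integrable ?N (\<lambda>y. f (1 + y))"
    by (rule finite_on_integrable[OF N, where C=D]) (auto intro!: D)
  have conv: "(\<integral>x. f x \<partial>pow_conv a (Suc n)) = (\<integral>x. (\<integral>y. f (x + y) \<partial>?N) \<partial>?M)"
    using finite_on_integral_convolution(1)[OF M N Suc.prems(1)] cf by (simp add: add.commute)
  have "(\<integral>x. x * f' x \<partial>pow_conv a (Suc n)) = (\<integral>x. (\<integral>y. (x + y) * f' (x + y) \<partial>?N) \<partial>?M)"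
    using finite_on_integral_convolution(1)[OF M N, of "\<lambda>x. x * f' x"] c
    by (simp add: add.commute continuous_intros)
  \<comment> \<open>Here x is the new coordinate, handled by \<open>pow_measure_ibp\<close> after a
    Fubini swap, and y is the sum of the old ones, handled by the induction hypothesis.\<close>
  also have "\<dots> = (\<integral>x. (\<integral>y. x * f' (x + y) + y * f' (x + y) \<partial>?N) \<partial>?M)"
    by (simp add: algebra_simps)
  also have "\<dots> = (\<integral>x. (\<integral>y. x * f' (x + y) \<partial>?N) \<partial>?M) + (\<integral>x. (\<integral>y. y * f' (x + y) \<partial>?N) \<partial>?M)"
  proof -
    have "(\<integral>x. (\<integral>y. x * f' (x + y) + y * f' (x + y) \<partial>?N) \<partial>?M)
       = (\<integral>p. (\<lambda>(x,y). x * f' (x + y)) p + (\<lambda>(x,y). y * f' (x + y)) p \<partial>(?M \<Otimes>\<^sub>M ?N))"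
      using P.integral_fst'[OF Bochner_Integration.integrable_add[OF ix iy]] by simp
    also have "\<dots> = (\<integral>p. (\<lambda>(x,y). x * f' (x + y)) p \<partial>(?M \<Otimes>\<^sub>M ?N)) + (\<integral>p. (\<lambda>(x,y). y * f' (x + y)) p \<partial>(?M \<Otimes>\<^sub>M ?N))"
      by (rule Bochner_Integration.integral_add[OF ix iy])
    finally show ?thesis
      using P.integral_fst'[OF ix] P.integral_fst'[OF iy] by simp
  qed
  also have "(\<integral>x. (\<integral>y. x * f' (x + y) \<partial>?N) \<partial>?M) = (\<integral>y. (\<integral>x. x * f' (x + y) \<partial>?M) \<partial>?N)"
    using P.Fubini_integral[OF ix] by simp
  also have "\<dots> = (\<integral>y. f (1 + y) - a * (\<integral>x. f (x + y) \<partial>?M) \<partial>?N)"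
  proof (rule integral_cong_AE)
    show "AE y in ?N. (\<integral>x. x * f' (x + y) \<partial>?M) = f (1 + y) - a * (\<integral>x. f (x + y) \<partial>?M)"
      using finite_onD(3)[OF N]
    proof eventually_elim
      case (elim y)
      show ?case
      proof (rule pow_measure_ibp[OF a])
        show "((\<lambda>x. f (x + y)) has_real_derivative f' (x + y)) (at x)" if "0 \<le> x" "x \<le> 1" for x
          using d[of "x + y"] that elim by (simp add: DERIV_shift)
        show "continuous_on {0..1} (\<lambda>x. f' (x + y))"
          using elim by (intro continuous_on_compose2[OF c] continuous_intros) auto
      qed measurable
    qed
  qed measurable
  also have "\<dots> = (\<integral>y. f (1 + y) \<partial>?N) - a * (\<integral>y. (\<integral>x. f (x + y) \<partial>?M) \<partial>?N)"
    using P.integrable_snd[OF iz] ig by simp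
  also have "(\<integral>y. (\<integral>x. f (x + y) \<partial>?M) \<partial>?N) = (\<integral>x. f x \<partial>pow_conv a (Suc n))"
    unfolding conv using P.Fubini_integral[OF iz] by simp
  also have "(\<integral>x. (\<integral>y. y * f' (x + y) \<partial>?N) \<partial>?M) =
     (\<integral>x. real n * ((\<integral>y. f (x + (1 + y)) \<partial>pow_conv a (n - 1)) - a * (\<integral>y. f (x + y) \<partial>?N)) \<partial>?M)"
  proof (rule integral_cong_AE)
    have [measurable_cong]: "sets (pow_conv a (n-1)) = sets borel"
      by (rule finite_onD(2)[OF finite_on_pow_conv[OF a]])
    interpret N1: finite_measure "pow_conv a (n-1)" by (rule finite_onD(1)[OF finite_on_pow_conv[OF a]])
    show "AE x in ?M. (\<integral>y. y * f' (x + y) \<partial>?N) =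
        real n * ((\<integral>y. f (x + (1 + y)) \<partial>pow_conv a (n - 1)) - a * (\<integral>y. f (x + y) \<partial>?N))"
      using finite_onD(3)[OF M]
    proof eventually_elim
      case (elim x)
      show ?case
      proof (rule Suc.IH)
        show "((\<lambda>y. f (x + y)) has_real_derivative f' (x + y)) (at y)" if "0 \<le> y" "y \<le> real n" for y
          unfolding add.commute[of x] using d[of "y + x"] that elim by (simp add: DERIV_shift)
        show "continuous_on {0..real n} (\<lambda>y. f' (x + y))"
          using elim by (intro continuous_on_compose2[OF c] continuous_intros) auto
      qed measurable
    qed
    show "(\<lambda>x. real n * ((\<integral>y. f (x + (1 + y)) \<partial>pow_conv a (n - 1)) - a * (\<integral>y. f (x + y) \<partial>?N))) \<in> borel_measurable ?M"
      by measurable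
  qed measurable
  also have "\<dots> = real n * ((\<integral>y. f (1 + y) \<partial>?N) - a * (\<integral>x. f x \<partial>pow_conv a (Suc n)))"
  \<comment> \<open>A face of the old cube, integrated over the new coordinate, is a face of the new
    cube: convolving \<open>pow_conv a (n - 1)\<close> with \<open>pow_measure a\<close> restores
    \<open>pow_conv a n\<close> when n > 0. For n = 0 both sides are 0.\<close>
  proof (cases n)
    case (Suc m)
    note N1 = finite_on_pow_conv[OF a, of m]
    have c1: "continuous_on {0..1 + real m} (\<lambda>y. f (1 + y))"
      by (auto intro!: continuous_intros continuous_on_compose2[OF cf] simp: Suc)
    have "(\<integral>y. f (1 + y) \<partial>?N) = (\<integral>x. (\<integral>y. f (1 + (x + y)) \<partial>pow_conv a m) \<partial>?M)"
      unfolding Suc pow_conv.simps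
      by (rule finite_on_integral_convolution[OF M N1 _ c1]) simp
    moreover have "integrable ?M (\<lambda>x. \<integral>y. f (1 + (x + y)) \<partial>pow_conv a m)"
      by (rule finite_on_integral_convolution[OF M N1 _ c1]) simp
    moreover have "integrable ?M (\<lambda>x. \<integral>y. f (x + y) \<partial>?N)"
      using P.integrable_fst'[OF iz] by simp
    ultimately show ?thesis unfolding conv
      by (simp add: Suc add.left_commute)
  qed simp
  finally show ?case by (simp add: algebra_simps)
qed

section \<open>Mass and first two moments of the untilted measure\<close>

lemma pow_conv_mass:
  assumes a: "a > 0" shows "(\<integral>x. 1 \<partial>pow_conv a n) = (1 / a) ^ n"
proof (induction n)
  case 0 then show ?case by (simp add: measure_return)
next
  case (Suc n)
  \<comment> \<open>With f = 1 the left side of the integration by parts vanishes, leaving a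
    recursion for the mass.\<close>
  have "(\<integral>x. x * 0 \<partial>pow_conv a (Suc n)) = real (Suc n) * ((\<integral>y. 1 \<partial>pow_conv a (Suc n - 1)) - a * (\<integral>x. 1 \<partial>pow_conv a (Suc n)))"
    by (rule pow_conv_ibp[OF a]) auto
  then have "(\<integral>y. 1 \<partial>pow_conv a n) = a * (\<integral>x. 1 \<partial>pow_conv a (Suc n))"
    by (simp del: pow_conv.simps lebesgue_integral_const)
  then show ?case using Suc a by (simp del: pow_conv.simps lebesgue_integral_const add: field_simps)
qed

lemma pow_conv_integrable:
  fixes f :: "real \<Rightarrow> real"
  assumes "a > 0" "f \<in> borel_measurable borel" "continuous_on {0..real n} f"
  shows "integrable (pow_conv a n) f"
  by (rule finite_on_integrable_cont[OF finite_on_pow_conv]) fact+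

text \<open>A normalised coordinate has the Beta(a, 1) law, of mean a/(a+1), and there are n of
  them. The recursion is \<open>pow_conv_ibp\<close> with f the identity.\<close>

lemma pow_conv_first_moment:
  assumes a: "a > 0" shows "(\<integral>x. x \<partial>pow_conv a n) = real n * a / (a + 1) * (1 / a) ^ n"
proof (induction n)
  case 0 then show ?case by (simp add: integral_return)
next
  case (Suc n)
  note i = pow_conv_integrable[OF a]
  have i1: "integrable (pow_conv a n) (\<lambda>y. y)" "integrable (pow_conv a n) (\<lambda>y. 1::real)" for n
    by (auto intro!: i continuous_intros)
  have "(\<integral>x. x * 1 \<partial>pow_conv a (Suc n)) = real (Suc n) * ((\<integral>y. 1 + y \<partial>pow_conv a (Suc n - 1)) - a * (\<integral>x. x \<partial>pow_conv a (Suc n)))"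
    by (rule pow_conv_ibp[OF a]) auto
  also have "(\<integral>y. 1 + y \<partial>pow_conv a (Suc n - 1)) = (1 / a) ^ n + real n * a / (a + 1) * (1 / a) ^ n"
    using Bochner_Integration.integral_add[OF i1(2)[of n] i1(1)[of n]] Suc pow_conv_mass[OF a, of n] by simp
  finally have "(1 + real (Suc n) * a) * (\<integral>x. x \<partial>pow_conv a (Suc n)) =
      real (Suc n) * ((1 / a) ^ n + real n * a / (a + 1) * (1 / a) ^ n)"
    by (simp add: algebra_simps)
  also have "\<dots> = (1 + real (Suc n) * a) * (real (Suc n) * a / (a + 1) * (1 / a) ^ Suc n)"
    using a by (simp add: divide_simps) (simp add: algebra_simps)
  finally have E: "(1 + real (Suc n) * a) * (\<integral>x. x \<partial>pow_conv a (Suc n)) =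
      (1 + real (Suc n) * a) * (real (Suc n) * a / (a + 1) * (1 / a) ^ Suc n)" .
  have "1 + real (Suc n) * a > 0" using a by (intro add_pos_nonneg) auto
  then have "1 + real (Suc n) * a \<noteq> 0" by simp
  from mult_left_cancel[OF this] E show ?case by blast
qed

text \<open>For n \<ge> 1 the exact ratio of the two moments is (n a (a+2) + 1) / ((a+1)(a+2));
  replacing the 1 by n gives this constant, which is attained at n = 1. With a = d/2 - 1 it equals n
  d/(d+2), the source of that factor in the bound on t.\<close>

lemma pow_conv_second_moment:
  assumes a: "a > 0"
  shows "(\<integral>x. x\<^sup>2 \<partial>pow_conv a n) \<le> real n * (a + 1) / (a + 2) * (\<integral>x. x \<partial>pow_conv a n)"
proof (induction n)
  case 0 then show ?case by (simp add: integral_return)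
next
  case (Suc n)
  note i = pow_conv_integrable[OF a]
  have i1: "integrable (pow_conv a n) (\<lambda>y. y)" "integrable (pow_conv a n) (\<lambda>y. 1::real)" "integrable (pow_conv a n) (\<lambda>y. y\<^sup>2)" for n
    by (auto intro!: i continuous_intros)
  define m where "m = (1 / a) ^ n"
  have m: "m > 0" using a by (simp add: m_def)
  have S: "(\<integral>x. x \<partial>pow_conv a n) = real n * a / (a + 1) * m"
     "(\<integral>x. x \<partial>pow_conv a (Suc n)) = real (Suc n) / (a + 1) * m"
    using pow_conv_first_moment[OF a, of n] pow_conv_first_moment[OF a, of "Suc n"] a
    by (simp_all add: m_def)
  have "(\<integral>x. x * (2 * x) \<partial>pow_conv a (Suc n)) = real (Suc n) * ((\<integral>y. (1 + y)\<^sup>2 \<partial>pow_conv a (Suc n - 1)) - a * (\<integral>x. x\<^sup>2 \<partial>pow_conv a (Suc n)))"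
    by (rule pow_conv_ibp[OF a]) (auto intro!: derivative_eq_intros continuous_intros)
  also have "(\<integral>x. x * (2 * x) \<partial>pow_conv a (Suc n)) = 2 * (\<integral>x. x\<^sup>2 \<partial>pow_conv a (Suc n))"
  proof -
    have "x * (2 * x) = 2 * x\<^sup>2" for x :: real by (simp add: power2_eq_square)
    then show ?thesis by (simp only: integral_mult_right_zero)
  qed
  also have "(\<integral>y. (1 + y)\<^sup>2 \<partial>pow_conv a (Suc n - 1)) = m + 2 * (\<integral>x. x \<partial>pow_conv a n) + (\<integral>x. x\<^sup>2 \<partial>pow_conv a n)"
    using i1[of n] pow_conv_mass[OF a, of n] by (simp add: power2_sum m_def)
  finally have "(2 + real (Suc n) * a) * (\<integral>x. x\<^sup>2 \<partial>pow_conv a (Suc n)) =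
      real (Suc n) * (m + 2 * (\<integral>x. x \<partial>pow_conv a n) + (\<integral>x. x\<^sup>2 \<partial>pow_conv a n))"
    by (simp add: algebra_simps)
  also have "\<dots> \<le> real (Suc n) * (m + 2 * (real n * a / (a + 1) * m) + real n * (a + 1) / (a + 2) * (real n * a / (a + 1) * m))"
    using Suc S by (intro mult_left_mono) auto
  also have "\<dots> = real (Suc n) * m * (1 + 2 * (real n * a / (a + 1)) + (real n)\<^sup>2 * a / (a + 2))"
    using a by (simp add: divide_simps) (simp add: algebra_simps power2_eq_square)
  also have "\<dots> \<le> real (Suc n) * m * ((2 + real (Suc n) * a) * (real (Suc n) / (a + 2)))"
  proof (rule mult_left_mono)
    have "(2 + real (Suc n) * a) * (real (Suc n) / (a + 2)) - (1 + 2 * (real n * a / (a + 1)) + (real n)\<^sup>2 * a / (a + 2))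
       = 2 * real n / ((a + 1) * (a + 2))"
      using a by (simp add: divide_simps) (simp add: algebra_simps power2_eq_square)
    moreover have "2 * real n / ((a + 1) * (a + 2)) \<ge> 0" using a by simp
    ultimately show "1 + 2 * (real n * a / (a + 1)) + (real n)\<^sup>2 * a / (a + 2) \<le> (2 + real (Suc n) * a) * (real (Suc n) / (a + 2))"
      by linarith
  qed (use m in simp)
  also have "\<dots> = (2 + real (Suc n) * a) * (real (Suc n) * (a + 1) / (a + 2) * (\<integral>x. x \<partial>pow_conv a (Suc n)))"
    using a unfolding S by (simp add: divide_simps)
  finally show ?case by (rule mult_left_le_imp_le) (use a in \<open>simp add: add_pos_nonneg\<close>)
qed

text \<open>Chebyshev's association inequality, pivoting at the $p$-mean $z$: $(x - z)(g(x) - g(z)) \<le> 0$.\<close>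

lemma chebyshev_pivot:
  fixes p g :: "real \<Rightarrow> real"
  assumes N: "finite_on b N" and z: "z \<ge> 0"
    and p: "\<And>x. 0 \<le> x \<Longrightarrow> p x \<ge> 0"
    and g: "\<And>x y. 0 \<le> x \<Longrightarrow> x \<le> y \<Longrightarrow> g y \<le> g x"
    and i1: "integrable N (\<lambda>x. p x * (x - z))" and i2: "integrable N (\<lambda>x. p x * (x - z) * g x)"
    and 0: "(\<integral>x. p x * (x - z) \<partial>N) = 0"
  shows "(\<integral>x. p x * (x - z) * g x \<partial>N) \<le> 0"
proof -
  have "(\<integral>x. p x * (x - z) * g x \<partial>N) \<le> (\<integral>x. p x * (x - z) * g z \<partial>N)"
  proof (rule integral_mono_AE)
    show "AE x in N. p x * (x - z) * g x \<le> p x * (x - z) * g z"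
      using finite_onD(3)[OF N]
    proof eventually_elim
      case (elim x)
      have "(x - z) * g x \<le> (x - z) * g z"
        using elim z g[of x z] g[of z x]
        by (cases "x \<le> z") (auto intro!: mult_left_mono mult_left_mono_neg)
      then show ?case using p[of x] elim by (simp add: mult.assoc mult_left_mono)
    qed
  qed (use i1 i2 in auto)
  also have "\<dots> = 0" using 0 i1 by simp
  finally show ?thesis .
qed

lemma finite_on_integral_nonneg:
  assumes "finite_on b N" "\<And>x. 0 \<le> x \<Longrightarrow> x \<le> b \<Longrightarrow> 0 \<le> (f x :: real)"
  shows "0 \<le> (\<integral>x. f x \<partial>N)"
  by (rule integral_nonneg_AE, rule eventually_mono[OF finite_onD(3)[OF assms(1)]]) (use assms(2) in auto)

text \<open>A constant lower bound together with the explicit positive mass gives strict positivity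
  without any discussion of null sets.\<close>

lemma pow_conv_integral_pos:
  fixes f :: "real \<Rightarrow> real"
  assumes a: "a > 0" and f: "integrable (pow_conv a n) f" and e: "\<epsilon> > 0"
    and le: "\<And>x. 0 \<le> x \<Longrightarrow> x \<le> real n \<Longrightarrow> \<epsilon> \<le> f x"
  shows "0 < (\<integral>x. f x \<partial>pow_conv a n)"
proof -
  have i: "integrable (pow_conv a n) (\<lambda>x. \<epsilon>)" by (rule pow_conv_integrable[OF a]) auto
  have "0 \<le> (\<integral>x. f x - \<epsilon> \<partial>pow_conv a n)"
    by (rule finite_on_integral_nonneg[OF finite_on_pow_conv[OF a]]) (use le in simp)
  also have "\<dots> = (\<integral>x. f x \<partial>pow_conv a n) - \<epsilon> * (\<integral>x. 1 \<partial>pow_conv a n)"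
    using f i by simp
  finally show ?thesis
    unfolding pow_conv_mass[OF a] using e a by (smt (verit) mult_pos_pos zero_less_power zero_less_divide_1_iff)
qed

subsection \<open>The variance bound\<close>

text \<open>The exponent a + 1 is half the dimension: this is the Gaussian mean of exp(-x |tZ + u|^2
  / 2v), computed by \<open>gauss_conv_exp\<close>.\<close>

definition tilt :: "real \<Rightarrow> real \<Rightarrow> real \<Rightarrow> real \<Rightarrow> real" where
  "tilt a \<tau> r x = (1 + \<tau> * x) powr (- (a + 1)) * exp (- r * (x / (1 + \<tau> * x)))"

lemma tilt_measurable [measurable]: "tilt a \<tau> r \<in> borel_measurable borel"
  unfolding tilt_def by measurable

lemma one_plus_pos: "0 \<le> \<tau> \<Longrightarrow> 0 \<le> x \<Longrightarrow> 0 < 1 + \<tau> * x" for \<tau> x :: real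
  by (simp add: add_pos_nonneg)

lemma one_plus_nz: "0 \<le> \<tau> \<Longrightarrow> 0 \<le> x \<Longrightarrow> 1 + \<tau> * x \<noteq> 0" for \<tau> x :: real
  using one_plus_pos[of \<tau> x] by simp

context
  fixes a \<tau> r :: real
  assumes a: "a > 0" and \<tau>: "\<tau> \<ge> 0" and r: "r \<ge> 0"
begin

lemma tilt_pos: "x \<ge> 0 \<Longrightarrow> tilt a \<tau> r x > 0"
  using one_plus_nz[OF \<tau>, of x] by (simp add: tilt_def)

lemma tilt_deriv:
  assumes "x \<ge> 0"
  shows "(tilt a \<tau> r has_real_derivative
    tilt a \<tau> r x * - ((a + 1) * \<tau> / (1 + \<tau> * x) + r / (1 + \<tau> * x)\<^sup>2)) (at x)"
proof -
  note [simp] = one_plus_pos[OF \<tau> assms] one_plus_nz[OF \<tau> assms]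
  have p: "(1 + \<tau> * x) powr (- (a + 1) - of_nat 1) = (1 + \<tau> * x) powr (- (a + 1)) / (1 + \<tau> * x)"
    using powr_diff[of "1 + \<tau> * x" "- (a + 1)" 1] powr_one[of "1 + \<tau> * x"] one_plus_pos[OF \<tau> assms] by simp
  have 1: "((\<lambda>x. (1 + \<tau> * x) powr (- (a + 1))) has_real_derivative
     (- (a + 1)) * (1 + \<tau> * x) powr (- (a + 1)) / (1 + \<tau> * x) * \<tau>) (at x)"
    by (rule DERIV_cong[OF DERIV_fun_powr[where g="\<lambda>x. 1 + \<tau> * x" and m=\<tau>]])
      (auto intro!: derivative_eq_intros simp: p[unfolded of_nat_1] simp del: minus_add_distrib)
  have 2: "((\<lambda>x. exp (- r * (x / (1 + \<tau> * x)))) has_real_derivative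
     - r * exp (- r * (x / (1 + \<tau> * x))) / (1 + \<tau> * x)\<^sup>2) (at x)"
    by (auto intro!: derivative_eq_intros simp: power2_eq_square divide_simps) (simp add: algebra_simps)
  show ?thesis unfolding tilt_def
    by (rule DERIV_cong[OF DERIV_mult[OF 1 2]]) (simp add: algebra_simps add_divide_distrib diff_divide_distrib)
qed

lemma tilt_cont: "S \<subseteq> {0..} \<Longrightarrow> continuous_on S (tilt a \<tau> r)"
  by (rule continuous_on_subset[of "{0..}"], rule DERIV_continuous_on)
    (auto intro: has_field_derivative_at_within tilt_deriv)

lemma tilt_antimono:
  assumes "0 \<le> x" "x \<le> y" shows "tilt a \<tau> r y \<le> tilt a \<tau> r x"
proof (rule DERIV_nonpos_imp_nonincreasing[OF assms(2)])
  fix z assume "x \<le> z"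
  then have z: "z \<ge> 0" using assms by simp
  show "\<exists>y. (tilt a \<tau> r has_real_derivative y) (at z) \<and> y \<le> 0"
  proof (intro exI conjI)
    show "(tilt a \<tau> r has_real_derivative
      tilt a \<tau> r z * - ((a + 1) * \<tau> / (1 + \<tau> * z) + r / (1 + \<tau> * z)\<^sup>2)) (at z)" by (rule tilt_deriv[OF z])
    have "(a + 1) * \<tau> / (1 + \<tau> * z) \<ge> 0" "r / (1 + \<tau> * z)\<^sup>2 \<ge> 0"
      using one_plus_pos[OF \<tau> z] a \<tau> r by auto
    then show "tilt a \<tau> r z * - ((a + 1) * \<tau> / (1 + \<tau> * z) + r / (1 + \<tau> * z)\<^sup>2) \<le> 0"
      using tilt_pos[OF z] by (intro mult_nonneg_nonpos) auto
  qed
qed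

text \<open>This is log-convexity of \<^const>\<open>tilt\<close>.\<close>

lemma tilt_ratio_antimono:
  assumes x: "0 \<le> x" "x \<le> 1" and y: "0 \<le> y" "y \<le> z"
  shows "tilt a \<tau> r (x + z) / tilt a \<tau> r (1 + z) \<le> tilt a \<tau> r (x + y) / tilt a \<tau> r (1 + y)"
proof -
  \<comment> \<open>The ratio factorises as \<open>q y powr (a + 1) * exp (r * e y)\<close>. Here
    \<open>e y\<close> is the increment of x/(1 + \<tau> x) from x + y to 1 + y, and both
    \<open>q\<close> and \<open>e\<close> decrease in y.\<close>
  define q where "q y = (1 + \<tau> * (1 + y)) / (1 + \<tau> * (x + y))" for y
  define e where "e y = (1 - x) / ((1 + \<tau> * (1 + y)) * (1 + \<tau> * (x + y)))" for y
  have eq: "tilt a \<tau> r (x + y) / tilt a \<tau> r (1 + y) = q y powr (a + 1) * exp (r * e y)" if "y \<ge> 0" for y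
  proof -
    have p: "1 + \<tau> * (1 + y) > 0" "1 + \<tau> * (x + y) > 0"
      using x that by (auto intro!: one_plus_pos[OF \<tau>])
    have "e y = (1 + y) / (1 + \<tau> * (1 + y)) - (x + y) / (1 + \<tau> * (x + y))"
      using p unfolding e_def by (simp add: divide_simps) (simp add: algebra_simps)
    then have "r * e y = - r * ((x + y) / (1 + \<tau> * (x + y))) - (- r * ((1 + y) / (1 + \<tau> * (1 + y))))"
      by (simp only: right_diff_distrib minus_mult_left[symmetric])
    then have "exp (r * e y) = exp (- r * ((x + y) / (1 + \<tau> * (x + y)))) / exp (- r * ((1 + y) / (1 + \<tau> * (1 + y))))"
      by (simp only: exp_diff)
    moreover have "q y powr (a + 1) = (1 + \<tau> * (x + y)) powr (- (a + 1)) / (1 + \<tau> * (1 + y)) powr (- (a + 1))"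
      using p unfolding q_def by (simp add: powr_minus powr_divide field_simps del: minus_add_distrib)
    ultimately show ?thesis by (simp add: tilt_def)
  qed
  have p: "1 + \<tau> * (1 + y) > 0" "1 + \<tau> * (x + y) > 0" "1 + \<tau> * (1 + z) > 0" "1 + \<tau> * (x + z) > 0"
    using x y by (auto intro!: one_plus_pos[OF \<tau>])
  have q: "q z \<le> q y"
  proof -
    have "q y = 1 + \<tau> * (1 - x) / (1 + \<tau> * (x + y))" "q z = 1 + \<tau> * (1 - x) / (1 + \<tau> * (x + z))"
      using p unfolding q_def by (simp_all add: divide_simps, simp_all add: algebra_simps)
    moreover have "\<tau> * (1 - x) / (1 + \<tau> * (x + z)) \<le> \<tau> * (1 - x) / (1 + \<tau> * (x + y))"
      using p x y \<tau> by (intro divide_left_mono) (auto intro!: mult_left_mono)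
    ultimately show ?thesis by simp
  qed
  have e: "e z \<le> e y"
    unfolding e_def using p x y \<tau> by (intro divide_left_mono mult_mono) (auto intro!: mult_left_mono)
  have "q z \<ge> 0" unfolding q_def using p by simp
  then have "q z powr (a + 1) * exp (r * e z) \<le> q y powr (a + 1) * exp (r * e y)"
    using q e a r by (intro mult_mono powr_mono2) (auto intro!: mult_left_mono)
  then show ?thesis using eq y by simp
qed

abbreviation "\<rho> \<equiv> tilt a \<tau> r"

lemmas tilt_cont_intros = continuous_on_compose2[OF tilt_cont[of "{0..}"]] continuous_intros

text \<open>The integrals over \<open>pow_conv a (n - 1)\<close> are boundary terms: they live on the face of the cube
  $[0,1]^n$ where one coordinate equals 1. The claim is that conditioning on that face increases
  the mean of the coordinate sum.\<close>

lemma tilt_face_mean: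
  assumes n: "n > 0"
  shows "(\<integral>x. x * \<rho> x \<partial>pow_conv a n) * (\<integral>y. \<rho> (1 + y) \<partial>pow_conv a (n - 1))
     \<le> (\<integral>y. (1 + y) * \<rho> (1 + y) \<partial>pow_conv a (n - 1)) * (\<integral>x. \<rho> x \<partial>pow_conv a n)"
proof -
  obtain m where m: "n = Suc m" using n by (cases n) auto
  let ?M = "pow_measure a" and ?N = "pow_conv a m"
  note M = finite_on_pow_measure[OF a] and N = finite_on_pow_conv[OF a, of m]
  note pos = tilt_pos
  define b0 where "b0 = (\<integral>y. \<rho> (1 + y) \<partial>?N)"
  define b1 where "b1 = (\<integral>y. (1 + y) * \<rho> (1 + y) \<partial>?N)"
  have i0: "integrable ?N (\<lambda>y. \<rho> (1 + y))" and i1: "integrable ?N (\<lambda>y. y * \<rho> (1 + y))"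
    by (auto intro!: pow_conv_integrable[OF a] tilt_cont_intros)
  have b0: "b0 > 0" unfolding b0_def
    by (rule pow_conv_integral_pos[OF a i0, of "\<rho> (1 + real m)"]) (auto intro!: pos tilt_antimono)
  have b1': "b1 = b0 + (\<integral>y. y * \<rho> (1 + y) \<partial>?N)"
    unfolding b0_def b1_def using i0 i1 by (simp add: distrib_right)
  have "0 \<le> (\<integral>y. y * \<rho> (1 + y) \<partial>?N)"
    by (rule finite_on_integral_nonneg[OF N]) (auto intro!: mult_nonneg_nonneg less_imp_le[OF pos])
  \<comment> \<open>So \<open>1 + z\<close> is the tilted mean of the coordinate sum on the face,
    and \<open>z\<close> that of the free coordinates.\<close>
  define z where "z = b1 / b0 - 1"
  have z: "z \<ge> 0" "b1 = (1 + z) * b0"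
    using b0 b1' \<open>0 \<le> (\<integral>y. y * \<rho> (1 + y) \<partial>?N)\<close> by (auto simp: z_def field_simps)
  \<comment> \<open>The cube is compared with the face slice by slice. Moving the slice from 1 to x
    multiplies the weight in y by a ratio that decreases in y, so by Chebyshev the mean of y stays
    at most \<open>z\<close>; and x itself is at most 1.\<close>
  have key: "(\<integral>y. (x + y) * \<rho> (x + y) \<partial>?N) \<le> (1 + z) * (\<integral>y. \<rho> (x + y) \<partial>?N)"
    if x: "0 \<le> x" "x \<le> 1" for x
  proof -
    have i2: "integrable ?N (\<lambda>y. \<rho> (x + y))" and i3: "integrable ?N (\<lambda>y. y * \<rho> (x + y))"
      using x by (auto intro!: pow_conv_integrable[OF a] tilt_cont_intros)
    have AE: "AE y in ?N. \<rho> (1 + y) * (y - z) * (\<rho> (x + y) / \<rho> (1 + y)) = y * \<rho> (x + y) - z * \<rho> (x + y)"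
      using finite_onD(3)[OF N]
    proof eventually_elim
      case (elim y)
      then show ?case using pos[of "1 + y"] by (simp add: field_simps)
    qed
    have meas: "(\<lambda>y. \<rho> (1 + y) * (y - z) * (\<rho> (x + y) / \<rho> (1 + y))) \<in> borel_measurable ?N"
      "(\<lambda>y. y * \<rho> (x + y) - z * \<rho> (x + y)) \<in> borel_measurable ?N"
      unfolding finite_onD(5)[OF N] by measurable
    have "(\<integral>y. \<rho> (1 + y) * (y - z) * (\<rho> (x + y) / \<rho> (1 + y)) \<partial>?N) \<le> 0"
    proof (rule chebyshev_pivot[OF N z(1)])
      show "integrable ?N (\<lambda>y. \<rho> (1 + y) * (y - z) * (\<rho> (x + y) / \<rho> (1 + y)))"
        using integrable_cong_AE[OF meas AE] i2 i3 by simp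
      show "integrable ?N (\<lambda>y. \<rho> (1 + y) * (y - z))"
        by (auto intro!: pow_conv_integrable[OF a] tilt_cont_intros)
      have "(\<integral>y. \<rho> (1 + y) * (y - z) \<partial>?N) = (\<integral>y. y * \<rho> (1 + y) - z * \<rho> (1 + y) \<partial>?N)"
        by (simp add: algebra_simps)
      also have "\<dots> = (b1 - b0) - z * b0" using i0 i1 b1' by (simp add: b0_def)
      finally show "(\<integral>y. \<rho> (1 + y) * (y - z) \<partial>?N) = 0" using z by (simp add: algebra_simps)
    qed (use x in \<open>auto intro!: less_imp_le[OF pos] tilt_ratio_antimono\<close>)
    also have "(\<integral>y. \<rho> (1 + y) * (y - z) * (\<rho> (x + y) / \<rho> (1 + y)) \<partial>?N) =
        (\<integral>y. y * \<rho> (x + y) \<partial>?N) - z * (\<integral>y. \<rho> (x + y) \<partial>?N)"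
      using integral_cong_AE[OF meas AE] i2 i3 by simp
    finally have 1: "(\<integral>y. y * \<rho> (x + y) \<partial>?N) \<le> z * (\<integral>y. \<rho> (x + y) \<partial>?N)" by simp
    have "0 \<le> (\<integral>y. \<rho> (x + y) \<partial>?N)"
      by (rule finite_on_integral_nonneg[OF N]) (use x in \<open>auto intro!: less_imp_le[OF pos]\<close>)
    then have 2: "x * (\<integral>y. \<rho> (x + y) \<partial>?N) \<le> 1 * (\<integral>y. \<rho> (x + y) \<partial>?N)"
      using x by (intro mult_right_mono)
    have "(\<integral>y. (x + y) * \<rho> (x + y) \<partial>?N) = x * (\<integral>y. \<rho> (x + y) \<partial>?N) + (\<integral>y. y * \<rho> (x + y) \<partial>?N)"
      using i2 i3 by (simp add: distrib_right)
    then show ?thesis using 1 2 by (simp add: algebra_simps)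
  qed
  have c0: "continuous_on {0..1 + real m} \<rho>" by (rule tilt_cont) auto
  have c1: "continuous_on {0..1 + real m} (\<lambda>x. x * \<rho> x)" by (intro continuous_intros c0)
  note C0 = finite_on_integral_convolution[OF M N tilt_measurable c0]
  note C1 = finite_on_integral_convolution[OF M N _ c1, simplified]
  have "(\<integral>x. x * \<rho> x \<partial>pow_conv a n) = (\<integral>x. (\<integral>y. (x + y) * \<rho> (x + y) \<partial>?N) \<partial>?M)"
    using C1(1) by (simp add: m)
  also have "\<dots> \<le> (\<integral>x. (1 + z) * (\<integral>y. \<rho> (x + y) \<partial>?N) \<partial>?M)"
  proof (rule integral_mono_AE)
    show "AE x in ?M. (\<integral>y. (x + y) * \<rho> (x + y) \<partial>?N) \<le> (1 + z) * (\<integral>y. \<rho> (x + y) \<partial>?N)"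
      using finite_onD(3)[OF M] by eventually_elim (auto intro: key)
  qed (use C0 C1 in auto)
  also have "\<dots> = (1 + z) * (\<integral>x. \<rho> x \<partial>pow_conv a n)"
    using C0 by (simp add: m)
  finally have "(\<integral>x. x * \<rho> x \<partial>pow_conv a n) * b0 \<le> (1 + z) * (\<integral>x. \<rho> x \<partial>pow_conv a n) * b0"
    using b0 by (intro mult_right_mono) auto
  then show ?thesis using z by (simp add: m b0_def b1_def mult_ac)
qed

text \<open>Chebyshev is used with weight x instead of 1: multiplying the size-biased measure by the
  decreasing \<open>\<rho>\<close> cannot raise its mean, so the untilted moment bound
  survives.\<close>

lemma tilt_size_biased_mean:
  assumes n: "n > 0"
  shows "(\<integral>x. x\<^sup>2 * \<rho> x \<partial>pow_conv a n) \<le> real n * (a + 1) / (a + 2) * (\<integral>x. x * \<rho> x \<partial>pow_conv a n)"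
proof -
  let ?N = "pow_conv a n"
  note N = finite_on_pow_conv[OF a, of n]
  note pos = tilt_pos
  define S where "S = (\<integral>x. x \<partial>?N)"
  define Q where "Q = (\<integral>x. x\<^sup>2 \<partial>?N)"
  have S: "S > 0" unfolding S_def pow_conv_first_moment[OF a] using n a by simp
  have Q: "Q \<ge> 0" unfolding Q_def by (rule finite_on_integral_nonneg[OF N]) auto
  \<comment> \<open>The untilted size-biased mean, which is the pivot that annihilates the integral
    of x (x - z).\<close>
  define z where "z = Q / S"
  have z: "z \<ge> 0" "Q = z * S" using S Q by (auto simp: z_def)
  have zle: "z \<le> real n * (a + 1) / (a + 2)"
    using pow_conv_second_moment[OF a, of n] S unfolding z_def S_def Q_def by (simp add: pos_divide_le_eq)
  have i: "integrable ?N (\<lambda>x. x)" "integrable ?N (\<lambda>x. x\<^sup>2)" "integrable ?N (\<lambda>x. x * \<rho> x)" "integrable ?N (\<lambda>x. x\<^sup>2 * \<rho> x)"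
    by (auto intro!: pow_conv_integrable[OF a] tilt_cont_intros)
  have "(\<integral>x. x * (x - z) * \<rho> x \<partial>?N) \<le> 0"
  proof (rule chebyshev_pivot[OF N z(1)])
    show "integrable ?N (\<lambda>x. x * (x - z))" "integrable ?N (\<lambda>x. x * (x - z) * \<rho> x)"
      by (auto intro!: pow_conv_integrable[OF a] tilt_cont_intros)
    have "(\<integral>x. x * (x - z) \<partial>?N) = (\<integral>x. x\<^sup>2 - z * x \<partial>?N)" by (simp add: algebra_simps power2_eq_square)
    also have "\<dots> = 0" using i z by (simp add: S_def Q_def)
    finally show "(\<integral>x. x * (x - z) \<partial>?N) = 0" .
  qed (auto intro!: tilt_antimono)
  also have "(\<integral>x. x * (x - z) * \<rho> x \<partial>?N) = (\<integral>x. x\<^sup>2 * \<rho> x - z * (x * \<rho> x) \<partial>?N)"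
    by (simp add: algebra_simps power2_eq_square)
  also have "\<dots> = (\<integral>x. x\<^sup>2 * \<rho> x \<partial>?N) - z * (\<integral>x. x * \<rho> x \<partial>?N)" using i by simp
  finally have 1: "(\<integral>x. x\<^sup>2 * \<rho> x \<partial>?N) \<le> z * (\<integral>x. x * \<rho> x \<partial>?N)" by simp
  have "0 \<le> (\<integral>x. x * \<rho> x \<partial>?N)"
    by (rule finite_on_integral_nonneg[OF N]) (auto intro!: mult_nonneg_nonneg less_imp_le[OF pos])
  then show ?thesis using 1 mult_right_mono[OF zle, of "\<integral>x. x * \<rho> x \<partial>?N"] by linarith
qed

text \<open>This is the inequality for the normalised means multiplied by half the squared mass,
  which removes all quotients; d has become 2 (a + 1). The assumption on \<tau> is the bound on t,
  since (a+1)/(a+2) = d/(d+2).\<close>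

lemma tilt_variance_bound:
  assumes n: "n \<ge> 2" and c: "0 < c" "c < 1"
    and \<tau>le: "(real n - 1) * \<tau> * (real n * (a + 1) / (a + 2)) \<le> 1 - c"
  defines "N \<equiv> pow_conv a n" and "lam \<equiv> \<lambda>x. x / (1 + \<tau> * x)"
  shows "(\<integral>x. \<rho> x \<partial>N) * (r * (\<integral>x. (lam x)\<^sup>2 * \<rho> x \<partial>N) - (a + 1) * (\<integral>x. lam x * \<rho> x \<partial>N))
    \<le> (1 - c / real n) * r * (\<integral>x. lam x * \<rho> x \<partial>N)\<^sup>2"
proof -
  note FN = finite_on_pow_conv[OF a, of n, folded N_def]
  note pos = tilt_pos and pp = one_plus_pos[OF \<tau>] and pz = one_plus_nz[OF \<tau>]
  note intg = pow_conv_integrable[OF a, of _ n, folded N_def]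
  define Z where "Z = (\<integral>x. \<rho> x \<partial>N)"
  define A where "A = (\<integral>x. x * \<rho> x \<partial>N)"
  define A2 where "A2 = (\<integral>x. x\<^sup>2 * \<rho> x \<partial>N)"
  define L where "L = (\<integral>x. lam x * \<rho> x \<partial>N)"
  define L2 where "L2 = (\<integral>x. (lam x)\<^sup>2 * \<rho> x \<partial>N)"
  define b0 where "b0 = (\<integral>y. \<rho> (1 + y) \<partial>pow_conv a (n - 1))"
  define b1 where "b1 = (\<integral>y. (1 + y) * \<rho> (1 + y) \<partial>pow_conv a (n - 1))"
  have [measurable]: "lam \<in> borel_measurable borel" unfolding lam_def by measurable
  have cl: "continuous_on {0..real n} lam"
    unfolding lam_def using pz by (intro continuous_intros) auto
  have iZ: "integrable N (\<lambda>x. \<rho> x)" and iA: "integrable N (\<lambda>x. x * \<rho> x)" and iA2: "integrable N (\<lambda>x. x\<^sup>2 * \<rho> x)"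
    and iL: "integrable N (\<lambda>x. lam x * \<rho> x)" and iL2: "integrable N (\<lambda>x. (lam x)\<^sup>2 * \<rho> x)"
    by (auto intro!: intg tilt_cont_intros cl)
  have ib0: "integrable (pow_conv a (n-1)) (\<lambda>y. \<rho> (1 + y))" and ib1: "integrable (pow_conv a (n-1)) (\<lambda>y. (1 + y) * \<rho> (1 + y))"
    by (auto intro!: pow_conv_integrable[OF a] tilt_cont_intros)
  have Z: "Z > 0" unfolding Z_def N_def
    by (rule pow_conv_integral_pos[OF a _ , of _ _ "\<rho> (real n)"])
       (auto intro!: pos tilt_antimono iZ[unfolded N_def])
  have A: "A \<ge> 0" unfolding A_def by (rule finite_on_integral_nonneg[OF FN]) (auto intro!: mult_nonneg_nonneg less_imp_le[OF pos])
  have A2: "A2 \<ge> 0" unfolding A2_def by (rule finite_on_integral_nonneg[OF FN]) (auto intro!: mult_nonneg_nonneg less_imp_le[OF pos])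
  have L: "L \<ge> 0" unfolding L_def lam_def
    by (rule finite_on_integral_nonneg[OF FN]) (auto intro!: mult_nonneg_nonneg divide_nonneg_nonneg less_imp_le[OF pos] less_imp_le[OF pp])
  have b0: "b0 \<ge> 0" unfolding b0_def
    by (rule finite_on_integral_nonneg[OF finite_on_pow_conv[OF a]]) (auto intro!: mult_nonneg_nonneg less_imp_le[OF pos])
  have b1: "b1 \<ge> 0" unfolding b1_def
    by (rule finite_on_integral_nonneg[OF finite_on_pow_conv[OF a]]) (auto intro!: mult_nonneg_nonneg less_imp_le[OF pos])

  let ?D = "\<lambda>x. (a + 1) * \<tau> / (1 + \<tau> * x) + r / (1 + \<tau> * x)\<^sup>2"
  have cD: "continuous_on {0..real n} ?D" using pz by (intro continuous_intros) auto
  \<comment> \<open>\<open>E1\<close> and \<open>E2\<close> integrate by parts against \<open>x * \<rho> x\<close> and \<open>(1 + \<tau> * x) * \<rho> x\<close>.\<close>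
  have E1: "r * L2 = (a + 1) * L + a * (real n - 1) * A - real n * b1"
  proof -
    have "(\<integral>x. x * (\<rho> x + x * (\<rho> x * - ?D x)) \<partial>N) = real n * ((\<integral>y. (1 + y) * \<rho> (1 + y) \<partial>pow_conv a (n - 1)) - a * (\<integral>x. x * \<rho> x \<partial>N))"
      unfolding N_def
    proof (rule pow_conv_ibp[OF a])
      show "((\<lambda>x. x * \<rho> x) has_real_derivative (\<rho> x + x * (\<rho> x * - ?D x))) (at x)" if "0 \<le> x" for x
        by (rule DERIV_cong[OF DERIV_mult[OF DERIV_ident tilt_deriv[OF that]]]) simp
      show "continuous_on {0..real n} (\<lambda>x. \<rho> x + x * (\<rho> x * - ?D x))"
        by (intro continuous_intros cD tilt_cont) auto
    qed measurable
    also have "(\<integral>x. x * (\<rho> x + x * (\<rho> x * - ?D x)) \<partial>N) =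
        (\<integral>x. (a + 1) * (lam x * \<rho> x) - a * (x * \<rho> x) - r * ((lam x)\<^sup>2 * \<rho> x) \<partial>N)"
    proof (rule integral_cong_AE)
      show "AE x in N. x * (\<rho> x + x * (\<rho> x * - ?D x)) = (a + 1) * (lam x * \<rho> x) - a * (x * \<rho> x) - r * ((lam x)\<^sup>2 * \<rho> x)"
        using finite_onD(3)[OF FN]
      proof eventually_elim
        case (elim x)
        define p where "p = 1 + \<tau> * x"
        \<comment> \<open>Replacing \<open>\<tau> * x\<close> by \<open>p - 1\<close> splits x
          (\<tau> x) / p into x - x/p, which is how both the plain first moment and that of
          \<open>lam\<close> appear.\<close>
        have p: "p \<noteq> 0" "\<tau> * x = p - 1" using pz elim by (auto simp: p_def)
        have "x * (\<rho> x + x * (\<rho> x * - ?D x)) = \<rho> x * (x - (a + 1) * x * (\<tau> * x) / p - r * (x / p)\<^sup>2)"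
          unfolding p_def[symmetric] by (simp add: algebra_simps power2_eq_square add_divide_distrib)
        also have "\<dots> = (a + 1) * (x / p * \<rho> x) - a * (x * \<rho> x) - r * ((x / p)\<^sup>2 * \<rho> x)"
          unfolding p(2) using p(1) by (simp add: field_simps)
        finally show ?case by (simp add: lam_def p_def)
      qed
    qed (simp_all add: finite_onD(5)[OF FN])
    also have "\<dots> = (a + 1) * L - a * A - r * L2"
      unfolding L_def A_def L2_def using iL iA iL2 by simp
    finally show ?thesis unfolding b1_def A_def by (simp add: algebra_simps)
  qed
  have E2: "r * L = a * real n * Z + a * (real n - 1) * \<tau> * A - real n * (b0 + \<tau> * b1)"
  proof -
    have "(\<integral>x. x * (\<tau> * \<rho> x + (1 + \<tau> * x) * (\<rho> x * - ?D x)) \<partial>N) = real n * ((\<integral>y. (1 + \<tau> * (1 + y)) * \<rho> (1 + y) \<partial>pow_conv a (n - 1)) - a * (\<integral>x. (1 + \<tau> * x) * \<rho> x \<partial>N))"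
      unfolding N_def
    proof (rule pow_conv_ibp[OF a])
      show "((\<lambda>x. (1 + \<tau> * x) * \<rho> x) has_real_derivative (\<tau> * \<rho> x + (1 + \<tau> * x) * (\<rho> x * - ?D x))) (at x)" if "0 \<le> x" for x
        by (rule DERIV_cong[OF DERIV_mult[OF _ tilt_deriv[OF that], of _ \<tau>]]) (auto intro!: derivative_eq_intros)
      show "continuous_on {0..real n} (\<lambda>x. \<tau> * \<rho> x + (1 + \<tau> * x) * (\<rho> x * - ?D x))"
        by (intro continuous_intros cD tilt_cont) auto
    qed measurable
    also have "(\<integral>x. x * (\<tau> * \<rho> x + (1 + \<tau> * x) * (\<rho> x * - ?D x)) \<partial>N) =
        (\<integral>x. - a * \<tau> * (x * \<rho> x) - r * (lam x * \<rho> x) \<partial>N)"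
    proof (rule integral_cong_AE)
      show "AE x in N. x * (\<tau> * \<rho> x + (1 + \<tau> * x) * (\<rho> x * - ?D x)) = - a * \<tau> * (x * \<rho> x) - r * (lam x * \<rho> x)"
        using finite_onD(3)[OF FN]
      proof eventually_elim
        case (elim x)
        define p where "p = 1 + \<tau> * x"
        have p: "p \<noteq> 0" using pz elim by (auto simp: p_def)
        \<comment> \<open>The multiplier \<open>p\<close> clears the denominator of (a+1) \<tau> / p
          and lowers r / p^2 to r / p, so only first moments of x and \<open>lam\<close>
          remain.\<close>
        then have "x * (\<tau> * \<rho> x + p * (\<rho> x * - ((a + 1) * \<tau> / p + r / p\<^sup>2))) = - a * \<tau> * (x * \<rho> x) - r * (x / p * \<rho> x)"
          by (simp add: field_simps power2_eq_square)
        then show ?case by (simp add: lam_def p_def)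
      qed
    qed (simp_all add: finite_onD(5)[OF FN])
    also have "\<dots> = - a * \<tau> * A - r * L"
      unfolding L_def A_def using iL iA by simp
    also have "(\<integral>y. (1 + \<tau> * (1 + y)) * \<rho> (1 + y) \<partial>pow_conv a (n - 1)) = (\<integral>y. \<rho> (1 + y) + \<tau> * ((1 + y) * \<rho> (1 + y)) \<partial>pow_conv a (n - 1))"
      by (simp add: algebra_simps)
    also have "\<dots> = b0 + \<tau> * b1"
      unfolding b0_def b1_def using ib0 ib1 by simp
    also have "(\<integral>x. (1 + \<tau> * x) * \<rho> x \<partial>N) = (\<integral>x. \<rho> x + \<tau> * (x * \<rho> x) \<partial>N)"
      by (simp add: algebra_simps)
    also have "\<dots> = Z + \<tau> * A" unfolding Z_def A_def using iZ iA by simp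
    finally show ?thesis by (simp add: algebra_simps)
  qed

  \<comment> \<open>Cauchy-Schwarz as the nonnegativity of a quadratic in \<open>s\<close>, taken at its minimiser.\<close>
  have CS: "A\<^sup>2 \<le> L * (A + \<tau> * A2)"
  proof (cases "A = 0")
    case False
    then have Q: "A + \<tau> * A2 > 0" using A A2 \<tau> by (intro add_pos_nonneg) auto
    define s where "s = A / (A + \<tau> * A2)"
    have "0 \<le> (\<integral>x. lam x * \<rho> x - 2 * s * (x * \<rho> x) + s\<^sup>2 * (x * \<rho> x + \<tau> * (x\<^sup>2 * \<rho> x)) \<partial>N)"
    proof (rule finite_on_integral_nonneg[OF FN])
      fix x :: real assume x: "0 \<le> x"
      define p where "p = 1 + \<tau> * x"
      have p: "p > 0" using pp x by (simp add: p_def)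
      \<comment> \<open>The Cauchy-Schwarz factors are the square roots of \<open>lam x\<close> and
        of x p, whose product is x; the combination is therefore x/p times the square of 1 - s
        p.\<close>
      have "lam x * \<rho> x - 2 * s * (x * \<rho> x) + s\<^sup>2 * (x * \<rho> x + \<tau> * (x\<^sup>2 * \<rho> x)) = \<rho> x * (x / p - 2 * s * x + s\<^sup>2 * x * p)"
        unfolding lam_def p_def by (simp add: algebra_simps power2_eq_square)
      also have "\<dots> = \<rho> x * (x / p * (1 - s * p)\<^sup>2)"
        using p by (simp add: field_simps power2_eq_square)
      also have "\<dots> \<ge> 0" using pos[OF x] x p by simp
      finally show "0 \<le> lam x * \<rho> x - 2 * s * (x * \<rho> x) + s\<^sup>2 * (x * \<rho> x + \<tau> * (x\<^sup>2 * \<rho> x))" .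
    qed
    also have "\<dots> = L - 2 * s * A + s\<^sup>2 * (A + \<tau> * A2)"
      unfolding L_def A_def A2_def using iL iA iA2 by simp
    also have "\<dots> = L - A\<^sup>2 / (A + \<tau> * A2)"
    proof -
      have "L - 2 * (A / q) * A + (A / q)\<^sup>2 * q = L - A\<^sup>2 / q" if "q > 0" for q
        using that by (simp add: field_simps power2_eq_square)
      from this[OF Q] show ?thesis by (simp add: s_def)
    qed
    finally show ?thesis using Q by (simp add: pos_divide_le_eq)
  qed (use L A2 \<tau> in simp)
  \<comment> \<open>Jensen for the concave \<open>lam\<close>, through its tangent at the mean \<open>z\<close>.\<close>
  have J: "L * (Z + \<tau> * A) \<le> A * Z"
  proof -
    define z where "z = A / Z"
    have z: "z \<ge> 0" "A = z * Z" using A Z by (auto simp: z_def)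
    define q where "q = 1 + \<tau> * z"
    have q: "q > 0" using pp z by (simp add: q_def)
    have "0 \<le> (\<integral>x. z / q * \<rho> x + (x * \<rho> x - z * \<rho> x) / q\<^sup>2 - lam x * \<rho> x \<partial>N)"
    proof (rule finite_on_integral_nonneg[OF FN])
      fix x :: real assume x: "0 \<le> x"
      define p where "p = 1 + \<tau> * x"
      have p: "p > 0" using pp x by (simp add: p_def)
      \<comment> \<open>The tangent has value z/q and slope 1/q^2 at z; its height above
        \<open>lam\<close> is \<tau> (x - z)^2 / (p q^2).\<close>
      have "z / q + (x - z) / q\<^sup>2 - x / p = (z * q * p + (x - z) * p - x * q\<^sup>2) / (p * q\<^sup>2)"
        using p q by (simp add: field_simps power2_eq_square)
      also have "z * q * p + (x - z) * p - x * q\<^sup>2 = \<tau> * (x - z)\<^sup>2"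
        unfolding p_def q_def by (simp add: algebra_simps power2_eq_square)
      finally have "z / q + (x - z) / q\<^sup>2 - x / p \<ge> 0" using p q \<tau> by simp
      then have "0 \<le> \<rho> x * (z / q + (x - z) / q\<^sup>2 - x / p)" using pos[OF x] by simp
      then show "0 \<le> z / q * \<rho> x + (x * \<rho> x - z * \<rho> x) / q\<^sup>2 - lam x * \<rho> x"
        unfolding lam_def p_def by (simp add: algebra_simps diff_divide_distrib)
    qed
    also have "\<dots> = z / q * Z + (A - z * Z) / q\<^sup>2 - L"
      unfolding L_def A_def Z_def using iL iA iZ by simp
    finally have "L \<le> A / q" using z by simp
    then have "L * q * Z \<le> A * Z" using q Z by (simp add: pos_le_divide_eq)
    then show ?thesis using z by (simp add: q_def algebra_simps)
  qed
  have S: "A2 \<le> real n * (a + 1) / (a + 2) * A"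
    using tilt_size_biased_mean[of n] n unfolding A2_def A_def N_def by simp
  have B: "A * b0 \<le> b1 * Z"
    using tilt_face_mean[of n] n unfolding A_def b0_def b1_def Z_def N_def by simp

  define \<kappa> where "\<kappa> = real n * (a + 1) / (a + 2)"
  have \<kappa>: "\<kappa> \<ge> 0" using a by (simp add: \<kappa>_def)
  define \<gamma> where "\<gamma> = 1 - c / real n"
  have \<gamma>: "\<gamma> \<ge> 0" "\<gamma> \<le> 1" "\<gamma> * real n = real n - c" using n c by (auto simp: \<gamma>_def field_simps)
  have n1: "real n - 1 \<ge> 0" using n by simp
  \<comment> \<open>Cauchy-Schwarz divided by \<open>A\<close>, with the size-biased mean bounded by
    \<kappa>; hence the separate case A = 0.\<close>
  have AL: "A \<le> L * (1 + \<tau> * \<kappa>)"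
  proof (cases "A = 0")
    case True then show ?thesis using L \<tau> \<kappa> by simp
  next
    case False
    have "A * A \<le> L * (A + \<tau> * (\<kappa> * A))"
      using CS mult_left_mono[OF mult_left_mono[OF S[folded \<kappa>_def] \<tau>] L] by (simp add: power2_eq_square algebra_simps)
    then have "A * A \<le> A * (L * (1 + \<tau> * \<kappa>))" by (simp add: algebra_simps)
    then show ?thesis using False A by simp
  qed
  \<comment> \<open>The interior comparison, and the only use of the bound on \<tau>: it says that
    (n-1)(1 + \<tau> \<kappa>) \<le> n - c.\<close>
  have P1: "(real n - 1) * A \<le> \<gamma> * L * real n"
  proof -
    have "(real n - 1) * A \<le> (real n - 1) * (L * (1 + \<tau> * \<kappa>))" using AL n1 by (rule mult_left_mono)
    also have "\<dots> = L * ((real n - 1) + (real n - 1) * \<tau> * \<kappa>)" by (simp add: algebra_simps)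
    also have "\<dots> \<le> L * (real n - c)" using L \<tau>le unfolding \<kappa>_def[symmetric] by (intro mult_left_mono) auto
    also have "\<dots> = \<gamma> * L * real n" using \<gamma>(3) by (metis mult.commute mult.assoc)
    finally show ?thesis .
  qed
  \<comment> \<open>The boundary comparison. Multiplying by Z + \<tau> A lets Jensen replace L by A
    Z, and the face-mean inequality then turns A b0 into b1 Z; the factor \<gamma> \<le> 1 is put in
    last.\<close>
  have P2: "\<gamma> * L * (b0 + \<tau> * b1) \<le> Z * b1"
  proof -
    have ZA: "Z + \<tau> * A > 0" using Z A \<tau> by (intro add_pos_nonneg) auto
    have "L * (b0 + \<tau> * b1) * (Z + \<tau> * A) = (L * (Z + \<tau> * A)) * (b0 + \<tau> * b1)" by simp
    also have "\<dots> \<le> (A * Z) * (b0 + \<tau> * b1)" using J b0 b1 \<tau> by (intro mult_right_mono) auto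
    also have "\<dots> = Z * (A * b0 + \<tau> * A * b1)" by (simp add: algebra_simps)
    also have "\<dots> \<le> Z * (b1 * Z + \<tau> * A * b1)" using B Z by (intro mult_left_mono) auto
    also have "\<dots> = (Z * b1) * (Z + \<tau> * A)" by (simp add: algebra_simps)
    finally have 1: "L * (b0 + \<tau> * b1) \<le> Z * b1" using ZA by (rule mult_right_le_imp_le)
    have "\<gamma> * (L * (b0 + \<tau> * b1)) \<le> 1 * (L * (b0 + \<tau> * b1))"
      using \<gamma> L b0 b1 \<tau> by (intro mult_right_mono) auto
    with 1 show ?thesis by (simp add: mult.assoc)
  qed
  have "Z * (r * L2 - (a + 1) * L) = a * Z * ((real n - 1) * A) - real n * (Z * b1)"
    unfolding E1 by (simp add: algebra_simps)
  also have "\<dots> \<le> a * Z * (\<gamma> * L * real n) - real n * (\<gamma> * L * (b0 + \<tau> * b1))"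
    using P1 P2 a Z n by (intro diff_mono mult_left_mono) auto
  \<comment> \<open>The added nonnegative term is the one missing from the right side of
    \<open>E2\<close>.\<close>
  also have "\<dots> \<le> a * Z * (\<gamma> * L * real n) - real n * (\<gamma> * L * (b0 + \<tau> * b1)) + \<gamma> * L * (a * (real n - 1) * \<tau> * A)"
    using \<gamma> L a n1 \<tau> A by simp
  also have "\<dots> = \<gamma> * L * (r * L)" unfolding E2 by (simp add: algebra_simps)
  finally show ?thesis
    unfolding Z_def[symmetric] L2_def[symmetric] L_def[symmetric] \<gamma>_def by (simp add: power2_eq_square mult_ac)
qed

end

subsection \<open>The harmonic marginal as a Gaussian mixture\<close>

lemma nn_integral_exp_square_real:
  assumes s: "s > 0"
  shows "(\<integral>\<^sup>+x. ennreal (exp (- x\<^sup>2 / (2 * s))) \<partial>lborel) = ennreal (sqrt (2 * pi * s))"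
proof -
  have "(\<integral>\<^sup>+x. ennreal (exp (- x\<^sup>2 / (2 * s))) \<partial>lborel) =
    (\<integral>\<^sup>+x. ennreal (sqrt (2 * pi * s)) * ennreal (normal_density 0 (sqrt s) x) \<partial>lborel)"
    using s by (intro nn_integral_cong) (simp add: normal_density_def ennreal_mult[symmetric])
  also have "\<dots> = ennreal (sqrt (2 * pi * s)) * ennreal 1"
    using s by (subst nn_integral_cmult) (auto simp: nn_integral_eq_integral)
  finally show ?thesis by simp
qed

lemma nn_integral_exp_square:
  assumes s: "s > 0"
  shows "(\<integral>\<^sup>+x. ennreal (exp (- (norm (x + y :: 'a :: euclidean_space))\<^sup>2 / (2 * s))) \<partial>lborel)
     = ennreal ((2 * pi * s) powr (real DIM('a) / 2))"
proof -
  have "(\<integral>\<^sup>+x. ennreal (exp (- (norm (x :: 'a))\<^sup>2 / (2 * s))) \<partial>lborel) =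
      (\<integral>\<^sup>+x. (\<Prod>b\<in>Basis. ennreal (exp (- ((x::'a) \<bullet> b)\<^sup>2 / (2 * s)))) \<partial>lborel)"
  proof (rule nn_integral_cong)
    fix x :: 'a
    have "(norm x)\<^sup>2 = (\<Sum>b\<in>Basis. (x \<bullet> b)\<^sup>2)"
      unfolding power2_norm_eq_inner euclidean_inner[of x x] by (simp add: power2_eq_square)
    then have "- (norm x)\<^sup>2 / (2 * s) = (\<Sum>b\<in>Basis. - (x \<bullet> b)\<^sup>2 / (2 * s))"
      by (simp add: sum_divide_distrib sum_negf)
    then show "ennreal (exp (- (norm x)\<^sup>2 / (2 * s))) = (\<Prod>b\<in>Basis. ennreal (exp (- (x \<bullet> b)\<^sup>2 / (2 * s))))"
      by (simp add: exp_sum prod_ennreal)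
  qed
  also have "\<dots> = (\<Prod>b\<in>(Basis::'a set). ennreal (sqrt (2 * pi * s)))"
    using nn_integral_exp_square_real[OF s]
    by (subst nn_integral_lborel_prod) auto
  also have "\<dots> = ennreal (sqrt (2 * pi * s) ^ DIM('a))"
    using s by (simp add: ennreal_power)
  also have "sqrt (2 * pi * s) ^ DIM('a) = (2 * pi * s) powr (real DIM('a) / 2)"
    using s by (simp add: powr_half_sqrt[symmetric] powr_realpow[symmetric] powr_powr)
  finally have *: "(\<integral>\<^sup>+x. ennreal (exp (- (norm (x :: 'a))\<^sup>2 / (2 * s))) \<partial>lborel) = ennreal ((2 * pi * s) powr (real DIM('a) / 2))" .
  have "(\<integral>\<^sup>+x. ennreal (exp (- (norm (x :: 'a))\<^sup>2 / (2 * s))) \<partial>lborel)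
     = (\<integral>\<^sup>+x. ennreal (exp (- (norm (x :: 'a))\<^sup>2 / (2 * s))) \<partial>distr lborel borel ((+) y))"
    by (simp add: lborel_distr_plus)
  also have "\<dots> = (\<integral>\<^sup>+x. ennreal (exp (- (norm (y + x :: 'a))\<^sup>2 / (2 * s))) \<partial>lborel)"
    by (subst nn_integral_distr) auto
  finally show ?thesis using * by (simp add: add.commute)
qed

lemma gauss_dens_measurable [measurable]: "(\<lambda>x::'a::euclidean_space. gauss_dens x s) \<in> borel_measurable borel"
  unfolding gauss_dens_def by measurable

lemma gauss_dens_nonneg: "gauss_dens x s \<ge> 0"
  by (simp add: gauss_dens_def)

text \<open>Complete the square in z: with q = 1 + k t^2 s, the exponent is that of a Gaussian of
  variance s/q centred at -(k t s/q) u, plus -k |u|^2 / (2q). It serves twice, for the marginal (t =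
  1, s = v) and for the mean over Z_1 (s = 1, k = x/v).\<close>

lemma gauss_conv_exp:
  fixes u :: "'a :: euclidean_space"
  assumes s: "s > 0" and k: "k \<ge> 0"
  shows "(\<integral>\<^sup>+z. ennreal (gauss_dens z s * exp (- k * (norm (t *\<^sub>R z + u))\<^sup>2 / 2)) \<partial>lborel)
    = ennreal ((1 + k * t\<^sup>2 * s) powr (- real DIM('a) / 2) * exp (- k * (norm u)\<^sup>2 / (2 * (1 + k * t\<^sup>2 * s))))"
proof -
  define q where "q = 1 + k * t\<^sup>2 * s"
  have q: "q > 0" using s k unfolding q_def by (simp add: add_pos_nonneg)
  define E where "E = exp (- k * (norm u)\<^sup>2 / (2 * q))"
  define D where "D = (2 * pi * s) powr (- real DIM('a) / 2)"
  have "gauss_dens z s * exp (- k * (norm (t *\<^sub>R z + u))\<^sup>2 / 2) =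
     (D * E) * exp (- (norm (z + (k * t * s / q) *\<^sub>R u))\<^sup>2 / (2 * (s / q)))" for z
  proof -
    have "(norm (t *\<^sub>R z + u))\<^sup>2 = t\<^sup>2 * (z \<bullet> z) + 2 * t * (z \<bullet> u) + u \<bullet> u"
      unfolding power2_norm_eq_inner by (simp add: inner_add_left inner_add_right inner_commute power2_eq_square algebra_simps)
    moreover have "(norm (z + (k * t * s / q) *\<^sub>R u))\<^sup>2 = z \<bullet> z + 2 * (k * t * s / q) * (z \<bullet> u) + (k * t * s / q)\<^sup>2 * (u \<bullet> u)"
      unfolding power2_norm_eq_inner by (simp add: inner_add_left inner_add_right inner_commute power2_eq_square algebra_simps)
    moreover have "- Z / (2 * s) + - k * (t\<^sup>2 * Z + 2 * t * W + U) / 2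
      = - k * U / (2 * q) + - (Z + 2 * (k * t * s / q) * W + (k * t * s / q)\<^sup>2 * U) / (2 * (s / q))" for Z W U :: real
    proof -
      have f1: "- (Z + 2 * (k * t * s / q) * W + (k * t * s / q)\<^sup>2 * U) / (2 * (s / q)) = - (q * Z / (2 * s)) - k * t * W - k * k * t * t * s / (2 * q) * U"
        using s q by (simp add: field_simps power2_eq_square)
      have f2: "q * Z / (2 * s) = Z / (2 * s) + k * t\<^sup>2 * Z / 2"
        using s by (simp add: q_def field_simps)
      have f3: "k * k * t * t * s / (2 * q) * U + k * U / (2 * q) = k * U / 2"
      proof -
        have "k * k * t * t * s / (2 * q) * U + k * U / (2 * q) = k * U * q / (2 * q)"
          unfolding add_divide_distrib[symmetric] times_divide_eq_left by (simp add: q_def power2_eq_square algebra_simps)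
        then show ?thesis using q by simp
      qed
      have f4: "- k * (t\<^sup>2 * Z + 2 * t * W + U) / 2 = - (k * t\<^sup>2 * Z / 2) - k * t * W - k * U / 2"
        by (simp add: field_simps)
      have f5: "- Z / (2 * s) = - (Z / (2 * s))" "- k * U / (2 * q) = - (k * U / (2 * q))" by simp_all
      show ?thesis unfolding f1 f4 f5 using f2 f3 by linarith
    qed
    ultimately show ?thesis
      unfolding gauss_dens_def D_def[symmetric] E_def
      by (simp only: mult.assoc exp_add[symmetric] power2_norm_eq_inner[of z] power2_norm_eq_inner[of u])
  qed
  then have "(\<integral>\<^sup>+z. ennreal (gauss_dens z s * exp (- k * (norm (t *\<^sub>R z + u))\<^sup>2 / 2)) \<partial>lborel)
    = (\<integral>\<^sup>+z. ennreal (D * E) * ennreal (exp (- (norm (z + (k * t * s / q) *\<^sub>R u))\<^sup>2 / (2 * (s / q)))) \<partial>lborel)"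
    by (simp add: ennreal_mult[symmetric] D_def E_def)
  also have "\<dots> = ennreal (D * E) * ennreal ((2 * pi * (s / q)) powr (real DIM('a) / 2))"
    using nn_integral_exp_square[of "s / q" "(k * t * s / q) *\<^sub>R u"] s q by (subst nn_integral_cmult) auto
  also have "\<dots> = ennreal (D * E * (2 * pi * (s / q)) powr (real DIM('a) / 2))"
    by (simp add: ennreal_mult[symmetric] D_def E_def)
  also have "D * E * (2 * pi * (s / q)) powr (real DIM('a) / 2) = q powr (- real DIM('a) / 2) * E"
  proof -
    have "(2 * pi * (s / q)) powr (real DIM('a) / 2) = (2 * pi * s) powr (real DIM('a) / 2) / q powr (real DIM('a) / 2)"
      using powr_divide[of "2 * pi * s" q "real DIM('a) / 2"] s q by simp
    then show ?thesis using s q unfolding D_def by (simp add: powr_minus field_simps)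
  qed
  finally show ?thesis by (simp add: E_def q_def)
qed

text \<open>Euler's Gamma integral rescaled by |x|^2 / 2, with k the precision of the mixed
  Gaussians. The origin must be excluded: there the mixture diverges while \<open>0 powr _\<close>
  is 0.\<close>

lemma norm_powr_mixture:
  fixes x :: "'a :: euclidean_space"
  assumes a: "a > 0" and x: "x \<noteq> 0"
  shows "ennreal (norm x powr (- (2 * a))) = ennreal (2 powr (- a) / Gamma a) *
     (\<integral>\<^sup>+k. ennreal (indicator {0<..} k * k powr (a - 1)) * ennreal (exp (- k * (norm x)\<^sup>2 / 2)) \<partial>lborel)"
proof -
  define c where "c = (norm x)\<^sup>2 / 2"
  have c: "c > 0" using x by (simp add: c_def)
  have G: "Gamma a > 0" using a by (simp add: Gamma_real_pos)
  let ?I = "\<integral>\<^sup>+k. ennreal (indicator {0<..} k * k powr (a - 1)) * ennreal (exp (- k * (norm x)\<^sup>2 / 2)) \<partial>lborel"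
  have "ennreal (Gamma a) = (\<integral>\<^sup>+t. ennreal (indicator {0..} t * t powr (a - 1) / exp t) \<partial>lborel)"
    by (rule Gamma_conv_nn_integral_real[OF a])
  also have "\<dots> = ennreal \<bar>c\<bar> * (\<integral>\<^sup>+t. ennreal (indicator {0..} (0 + c * t) * (0 + c * t) powr (a - 1) / exp (0 + c * t)) \<partial>lborel)"
    using c by (subst nn_integral_real_affine[where c=c and t=0]) auto
  also have "(\<integral>\<^sup>+t. ennreal (indicator {0..} (0 + c * t) * (0 + c * t) powr (a - 1) / exp (0 + c * t)) \<partial>lborel)
     = (\<integral>\<^sup>+k. ennreal (c powr (a - 1)) * (ennreal (indicator {0<..} k * k powr (a - 1)) * ennreal (exp (- k * (norm x)\<^sup>2 / 2))) \<partial>lborel)"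
  proof (rule nn_integral_cong)
    fix t :: real
    have "t > 0 \<Longrightarrow> (c * t) powr (a - 1) = c powr (a - 1) * t powr (a - 1)" using c by (simp add: powr_mult)
    moreover have "exp (- t * (norm x)\<^sup>2 / 2) = 1 / exp (c * t)" unfolding c_def by (simp add: exp_minus field_simps)
    ultimately show "ennreal (indicator {0..} (0 + c * t) * (0 + c * t) powr (a - 1) / exp (0 + c * t)) =
      ennreal (c powr (a - 1)) * (ennreal (indicator {0<..} t * t powr (a - 1)) * ennreal (exp (- t * (norm x)\<^sup>2 / 2)))"
      using c by (cases "t = 0") (auto simp: indicator_def zero_le_mult_iff ennreal_mult[symmetric])
  qed
  also have "\<dots> = ennreal (c powr (a - 1)) * ?I"
    by (subst nn_integral_cmult) auto
  finally have "ennreal (Gamma a) = ennreal (c powr a) * ?I"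
    using c by (simp add: ennreal_mult[symmetric] mult.assoc[symmetric] powr_diff)
  then have "ennreal (c powr (- a) / Gamma a) * ennreal (Gamma a) = ennreal (c powr (- a) / Gamma a) * ennreal (c powr a) * ?I"
    by (simp add: mult.assoc)
  also have "ennreal (c powr (- a) / Gamma a) * ennreal (Gamma a) = ennreal (c powr (- a))"
    using G by (simp add: ennreal_mult[symmetric])
  also have "ennreal (c powr (- a) / Gamma a) * ennreal (c powr a) = ennreal (1 / Gamma a)"
    using G c by (simp add: ennreal_mult[symmetric] powr_minus)
  finally have 1: "ennreal (c powr (- a)) = ennreal (1 / Gamma a) * ?I" .
  have "c powr (- a) = norm x powr (- (2 * a)) * 2 powr a"
  proof -
    have "(norm x)\<^sup>2 = norm x powr 2" using x by simp
    then have "c powr (- a) = (norm x powr 2) powr (- a) / 2 powr (- a)" unfolding c_def by (simp add: powr_divide)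
    also have "(norm x powr 2) powr (- a) = norm x powr (- (2 * a))" unfolding powr_powr by simp
    finally show ?thesis by (simp add: powr_minus divide_inverse)
  qed
  then have "norm x powr (- (2 * a)) = 2 powr (- a) * c powr (- a)" by (simp add: powr_minus)
  then have "ennreal (norm x powr (- (2 * a))) = ennreal (2 powr (- a)) * ennreal (c powr (- a))"
    by (simp add: ennreal_mult[symmetric])
  then show ?thesis unfolding 1 using G by (simp add: ennreal_mult[symmetric] mult.assoc[symmetric])
qed

text \<open>Substitute x = k v / (1 + k v), which maps the precisions onto (0,1) and makes the
  exponent linear in x. The exponents a - 1 and a + 1 differ by 2, so all powers of 1 - x cancel
  against the Jacobian; this is special to the harmonic prior, where a = d/2 - 1.\<close>

lemma exp_pow_measure_substitution:
  assumes a: "a > 0" and v: "v > 0" and b: "b \<ge> 0"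
  shows "(\<integral>\<^sup>+k. ennreal (indicator {0<..} k * k powr (a - 1) * ((1 + k * v) powr (- (a + 1)) * exp (- k * b / (1 + k * v)))) \<partial>lborel)
    = ennreal (v powr (- a) * (\<integral>x. exp (- (b / v) * x) \<partial>pow_measure a))"
proof -
  let ?S = "{0<..<1::real}"
  define f where "f k = k powr (a - 1) * ((1 + k * v) powr (- (a + 1)) * exp (- k * b / (1 + k * v)))" for k
  define g where "g x = x / (v * (1 - x))" for x :: real
  define g' where "g' x = 1 / (v * (1 - x)\<^sup>2)" for x :: real
  define h where "h x = v powr (- a) * (x powr (a - 1) * exp (- (b / v) * x))" for x
  have hg: "\<bar>g' x\<bar> * f (g x) = h x" if "x \<in> ?S" for x
  proof -
    have x: "0 < x" "x < 1" using that by auto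
    have p: "1 + g x * v = 1 / (1 - x)" using x v by (simp add: g_def field_simps)
    have 1: "g x powr (a - 1) = x powr (a - 1) * v powr (1 - a) * (1 - x) powr (1 - a)"
    proof -
      have "g x powr (a - 1) = x powr (a - 1) / (v powr (a - 1) * (1 - x) powr (a - 1))"
        unfolding g_def using x v by (simp add: powr_divide powr_mult del: right_diff_distrib)
      moreover have "v powr (1 - a) = inverse (v powr (a - 1))" "(1 - x) powr (1 - a) = inverse ((1 - x) powr (a - 1))"
        by (simp_all add: powr_minus[symmetric])
      ultimately show ?thesis by (simp add: field_simps)
    qed
    have 2: "(1 + g x * v) powr (- (a + 1)) = (1 - x) powr (a + 1)"
      unfolding p using x by (simp add: powr_divide powr_minus del: minus_add_distrib)
    have 3: "- g x * b / (1 + g x * v) = - (b / v) * x"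
      unfolding p unfolding g_def using x v by (simp add: field_simps)
    \<comment> \<open>This cancels the factor (1 - x)^(-2) of the Jacobian
      \<open>g'\<close>.\<close>
    have 4: "(1 - x) powr (1 - a) * (1 - x) powr (a + 1) = (1 - x)\<^sup>2"
      using x by (simp add: powr_add[symmetric])
    have 5: "v powr (1 - a) = v * v powr (- a)" using v by (simp add: powr_diff powr_minus field_simps)
    have "\<bar>g' x\<bar> * f (g x) = 1 / (v * (1 - x)\<^sup>2) * (x powr (a - 1) * v powr (1 - a) * ((1 - x) powr (1 - a) * (1 - x) powr (a + 1)) * exp (- (b / v) * x))"
      unfolding f_def 1 2 3 g'_def using v by (simp add: mult_ac)
    also have "\<dots> = h x" unfolding 4 5 h_def using v x by (simp add: field_simps)
    finally show ?thesis .
  qed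
  have gS: "g ` ?S = {0<..}"
  proof safe
    fix y :: real assume y: "y > 0"
    have "1 + v * y > 0" using y v by (simp add: add_pos_pos)
    moreover from this have "1 - v * y / (1 + v * y) = 1 / (1 + v * y)" by (simp add: field_simps)
    ultimately have "y = g (v * y / (1 + v * y))" "v * y / (1 + v * y) \<in> ?S"
      unfolding g_def using y v by (simp_all add: divide_simps)
    then show "y \<in> g ` ?S" by blast
  qed (use v in \<open>auto simp: g_def\<close>)
  have inj: "inj_on g ?S"
    using v by (auto simp: inj_on_def g_def field_simps)
  have der: "(g has_field_derivative g' x) (at x within ?S)" if "x \<in> ?S" for x
  proof -
    have "(g has_field_derivative (1 * (v * (1 - x)) - x * (v * - 1)) / (v * (1 - x) * (v * (1 - x)))) (at x within ?S)"
      unfolding g_def by (rule DERIV_divide) (use that v in \<open>auto intro!: derivative_eq_intros\<close>)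
    moreover have "1 * (v * (1 - x)) - x * (v * - 1) = v" by (simp add: algebra_simps)
    ultimately show ?thesis using v by (simp add: g'_def power2_eq_square mult_ac)
  qed
  have ih: "integrable (pow_measure a) (\<lambda>x. exp (- (b / v) * x))"
    by (rule finite_on_integrable_cont[OF finite_on_pow_measure[OF a]]) (use v in \<open>auto intro!: continuous_intros\<close>)
  then have il: "integrable lborel (\<lambda>x. indicator ?S x * h x)"
    unfolding pow_measure_def h_def
    by (subst (asm) integrable_density) (auto simp: indicator_def mult_ac)
  have "(\<integral>x. indicator ?S x * h x \<partial>lborel) = (\<integral>x. v powr (- a) * (indicator ?S x * x powr (a - 1) * exp (- (b / v) * x)) \<partial>lborel)"
    by (simp add: h_def mult_ac)
  also have "\<dots> = v powr (- a) * (\<integral>x. exp (- (b / v) * x) \<partial>pow_measure a)"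
    by (subst integral_pow_measure) (auto intro!: integral_mult_right_zero)
  finally have Ih: "(\<integral>x. indicator ?S x * h x \<partial>lborel) = v powr (- a) * (\<integral>x. exp (- (b / v) * x) \<partial>pow_measure a)" .
  have hs: "set_integrable lebesgue ?S h"
    unfolding set_integrable_def using il by (simp add: integrable_completion)
  have hI: "(h has_integral (v powr (- a) * (\<integral>x. exp (- (b / v) * x) \<partial>pow_measure a))) ?S"
  proof -
    have "((\<lambda>x. if x \<in> ?S then h x else 0) has_integral (\<integral>x. indicator ?S x * h x \<partial>lborel)) UNIV"
      by (rule has_integral_eq[OF _ has_integral_integral_lborel[OF il]]) (auto simp: indicator_def)
    then show ?thesis unfolding Ih by (simp only: has_integral_restrict_UNIV)
  qed
  have "(\<lambda>x. \<bar>g' x\<bar> * f (g x)) absolutely_integrable_on ?S"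
    using hs by (subst set_integrable_cong[OF refl refl hg])
  moreover have "integral ?S (\<lambda>x. \<bar>g' x\<bar> * f (g x)) = v powr (- a) * (\<integral>x. exp (- (b / v) * x) \<partial>pow_measure a)"
    by (rule integral_unique, rule has_integral_eq[OF _ hI]) (use hg in simp)
  ultimately have "(\<lambda>x. \<bar>g' x\<bar> * f (g x)) absolutely_integrable_on ?S \<and>
      integral ?S (\<lambda>x. \<bar>g' x\<bar> * f (g x)) = v powr (- a) * (\<integral>x. exp (- (b / v) * x) \<partial>pow_measure a)" ..
  then have "f absolutely_integrable_on g ` ?S \<and> integral (g ` ?S) f = v powr (- a) * (\<integral>x. exp (- (b / v) * x) \<partial>pow_measure a)"
    by (subst (asm) has_absolute_integral_change_of_variables_1'[OF _ der inj]) auto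
  then have "(f has_integral v powr (- a) * (\<integral>x. exp (- (b / v) * x) \<partial>pow_measure a)) {0<..}"
    unfolding gS using set_lebesgue_integral_eq_integral(1) has_integral_integrable_integral by blast
  then have "integral\<^sup>N lborel (\<lambda>x. indicator {0<..} x * f x) = ennreal (v powr (- a) * (\<integral>x. exp (- (b / v) * x) \<partial>pow_measure a))"
    by (rule nn_integral_has_integral_lebesgue[rotated]) (simp add: f_def)
  then show ?thesis by (simp add: f_def mult_ac)
qed

text \<open>The prior becomes a mixture over precisions k, the Gaussian integral over \<mu> is done
  first, and the remaining k-integral is moved to (0,1). The computation uses nonnegative extended
  integrals, so the interchange needs only measurability.\<close>

lemma m_H_mixture:
  assumes d: "DIM('a::euclidean_space) \<ge> 3" and v: "v > 0"
  defines "a \<equiv> real DIM('a) / 2 - 1"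
  shows "m_H (w :: 'a) v = 2 powr (- a) / Gamma a * v powr (- a) * (\<integral>x. exp (- ((norm w)\<^sup>2 / (2 * v)) * x) \<partial>pow_measure a)"
proof -
  have a: "a > 0" using d by (simp add: a_def)
  have G: "Gamma a > 0" using a by (simp add: Gamma_real_pos)
  define C where "C = 2 powr (- a) / Gamma a"
  have C: "C \<ge> 0" using G by (simp add: C_def)
  have e: "- (real DIM('a) - 2) = - (2 * a)" by (simp add: a_def)
  let ?J = "\<integral>x. exp (- ((norm w)\<^sup>2 / (2 * v)) * x) \<partial>pow_measure a"
  have "(\<integral>\<^sup>+\<mu>. ennreal (gauss_dens (w - \<mu>) v * norm \<mu> powr (- (real DIM('a) - 2))) \<partial>lborel)
    = (\<integral>\<^sup>+\<mu>. (\<integral>\<^sup>+k. ennreal C * (ennreal (gauss_dens (w - \<mu>) v) * (ennreal (indicator {0<..} k * k powr (a - 1)) * ennreal (exp (- k * (norm \<mu>)\<^sup>2 / 2)))) \<partial>lborel) \<partial>lborel)"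
  proof (rule nn_integral_cong_AE)
    show "AE \<mu> in lborel. ennreal (gauss_dens (w - \<mu>) v * norm \<mu> powr (- (real DIM('a) - 2))) =
       (\<integral>\<^sup>+k. ennreal C * (ennreal (gauss_dens (w - \<mu>) v) * (ennreal (indicator {0<..} k * k powr (a - 1)) * ennreal (exp (- k * (norm \<mu>)\<^sup>2 / 2)))) \<partial>lborel)"
      \<comment> \<open>The mixture formula fails only at \<mu> = 0, a null set.\<close>
      using AE_lborel_singleton[of 0]
    proof eventually_elim
      case (elim \<mu>)
      have "ennreal (gauss_dens (w - \<mu>) v * norm \<mu> powr (- (real DIM('a) - 2))) = ennreal (gauss_dens (w - \<mu>) v) * ennreal (norm \<mu> powr (- (2 * a)))"
        unfolding e by (simp add: ennreal_mult gauss_dens_nonneg)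
      also have "\<dots> = ennreal C * (ennreal (gauss_dens (w - \<mu>) v) * (\<integral>\<^sup>+k. ennreal (indicator {0<..} k * k powr (a - 1)) * ennreal (exp (- k * (norm \<mu>)\<^sup>2 / 2)) \<partial>lborel))"
        unfolding norm_powr_mixture[OF a elim] C_def by (simp add: mult_ac)
      also have "\<dots> = (\<integral>\<^sup>+k. ennreal C * (ennreal (gauss_dens (w - \<mu>) v) * (ennreal (indicator {0<..} k * k powr (a - 1)) * ennreal (exp (- k * (norm \<mu>)\<^sup>2 / 2)))) \<partial>lborel)"
        by (simp add: nn_integral_cmult)
      finally show ?case .
    qed
  qed
  also have "\<dots> = (\<integral>\<^sup>+k. (\<integral>\<^sup>+\<mu>. ennreal C * (ennreal (gauss_dens (w - \<mu>) v) * (ennreal (indicator {0<..} k * k powr (a - 1)) * ennreal (exp (- k * (norm \<mu>)\<^sup>2 / 2)))) \<partial>lborel) \<partial>lborel)"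
    by (rule lborel_pair.Fubini') measurable
  also have "\<dots> = (\<integral>\<^sup>+k. ennreal C * ennreal (indicator {0<..} k * k powr (a - 1) * ((1 + k * v) powr (- (a + 1)) * exp (- k * ((norm w)\<^sup>2 / 2) / (1 + k * v)))) \<partial>lborel)"
  proof (rule nn_integral_cong)
    fix k :: real
    show "(\<integral>\<^sup>+\<mu>. ennreal C * (ennreal (gauss_dens (w - \<mu>) v) * (ennreal (indicator {0<..} k * k powr (a - 1)) * ennreal (exp (- k * (norm \<mu>)\<^sup>2 / 2)))) \<partial>lborel)
      = ennreal C * ennreal (indicator {0<..} k * k powr (a - 1) * ((1 + k * v) powr (- (a + 1)) * exp (- k * ((norm w)\<^sup>2 / 2) / (1 + k * v))))"
    proof (cases "k > 0")
      case True
      have "(\<integral>\<^sup>+\<mu>. ennreal C * (ennreal (gauss_dens (w - \<mu>) v) * (ennreal (indicator {0<..} k * k powr (a - 1)) * ennreal (exp (- k * (norm \<mu>)\<^sup>2 / 2)))) \<partial>lborel)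
        = (\<integral>\<^sup>+\<mu>. ennreal C * ennreal (k powr (a - 1)) * ennreal (gauss_dens (w - \<mu>) v * exp (- k * (norm \<mu>)\<^sup>2 / 2)) \<partial>lborel)"
        using True by (intro nn_integral_cong) (simp add: ennreal_mult gauss_dens_nonneg mult_ac)
      also have "\<dots> = ennreal C * ennreal (k powr (a - 1)) * (\<integral>\<^sup>+\<mu>. ennreal (gauss_dens (w - \<mu>) v * exp (- k * (norm \<mu>)\<^sup>2 / 2)) \<partial>lborel)"
        by (rule nn_integral_cmult) measurable
      also have "(\<integral>\<^sup>+\<mu>. ennreal (gauss_dens (w - \<mu>) v * exp (- k * (norm \<mu>)\<^sup>2 / 2)) \<partial>lborel) =
         (\<integral>\<^sup>+\<mu>. ennreal (gauss_dens (w - \<mu>) v * exp (- k * (norm \<mu>)\<^sup>2 / 2)) \<partial>distr lborel borel ((+) w))"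
        by (simp add: lborel_distr_plus)
      \<comment> \<open>Translation by w together with the evenness of the Gaussian density.\<close>
      also have "\<dots> = (\<integral>\<^sup>+z. ennreal (gauss_dens z v * exp (- k * (norm (1 *\<^sub>R z + w))\<^sup>2 / 2)) \<partial>lborel)"
        by (subst nn_integral_distr) (auto simp: gauss_dens_def add.commute)
      also have "\<dots> = ennreal ((1 + k * v) powr (- (a + 1)) * exp (- k * ((norm w)\<^sup>2 / 2) / (1 + k * v)))"
      proof -
        have e2: "- real DIM('a) / 2 = - (a + 1)" by (simp add: a_def)
        have e3: "- k * (norm w)\<^sup>2 / (2 * (1 + k * 1\<^sup>2 * v)) = - k * ((norm w)\<^sup>2 / 2) / (1 + k * v)" by simp
        show ?thesis
          unfolding gauss_conv_exp[OF v less_imp_le[OF True]] e2 e3 by simp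
      qed
      finally show ?thesis using True by (simp add: ennreal_mult mult_ac)
    qed simp
  qed
  also have "\<dots> = ennreal C * ennreal (v powr (- a) * (\<integral>x. exp (- ((norm w)\<^sup>2 / 2 / v) * x) \<partial>pow_measure a))"
    by (subst nn_integral_cmult, measurable, subst exp_pow_measure_substitution[OF a v]) auto
  also have "(norm w)\<^sup>2 / 2 / v = (norm w)\<^sup>2 / (2 * v)" by simp
  also have "ennreal C * ennreal (v powr (- a) * ?J) = ennreal (C * v powr (- a) * ?J)"
    using C by (simp add: ennreal_mult[symmetric] mult.assoc)
  finally have *: "(\<integral>\<^sup>+\<mu>. ennreal (gauss_dens (w - \<mu>) v * norm \<mu> powr (- (real DIM('a) - 2))) \<partial>lborel) = ennreal (C * v powr (- a) * ?J)" .
  have "m_H w v = enn2real (\<integral>\<^sup>+\<mu>. ennreal (gauss_dens (w - \<mu>) v * norm \<mu> powr (- (real DIM('a) - 2))) \<partial>lborel)"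
    unfolding m_H_def by (rule integral_eq_nn_integral) (auto simp: gauss_dens_nonneg)
  also have "\<dots> = C * v powr (- a) * ?J"
    unfolding * using C by (intro enn2real_ennreal mult_nonneg_nonneg) auto
  finally show ?thesis by (simp add: C_def)
qed

lemma exp_pow_measure_power:
  assumes a: "a > 0"
  shows "(\<integral>x. exp (- b * x) \<partial>pow_measure a) ^ n = (\<integral>x. exp (- b * x) \<partial>pow_conv a n)"
proof (induction n)
  case 0 then show ?case by (simp add: integral_return)
next
  case (Suc n)
  have "(\<integral>x. exp (- b * x) \<partial>pow_conv a (Suc n)) = (\<integral>x. (\<integral>y. exp (- b * (x + y)) \<partial>pow_conv a n) \<partial>pow_measure a)"
    unfolding pow_conv.simps
    by (rule finite_on_integral_convolution[OF finite_on_pow_measure[OF a] finite_on_pow_conv[OF a]])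
      (auto intro!: continuous_intros)
  also have "\<dots> = (\<integral>x. exp (- b * x) * (\<integral>y. exp (- b * y) \<partial>pow_conv a n) \<partial>pow_measure a)"
    by (simp only: distrib_left exp_add integral_mult_right_zero)
  also have "\<dots> = (\<integral>x. exp (- b * x) \<partial>pow_measure a) ^ Suc n"
    using Suc by simp
  finally show ?case by simp
qed

section \<open>The Gaussian mean of a power of the marginal\<close>

text \<open>The marginal is a Laplace transform in |w|^2 / 2v, so its n-th power is the transform of
  the n-fold convolution. Tonelli then leaves one Gaussian integral for each x.\<close>

lemma gauss_mean_m_H_power:
  assumes d: "DIM('a::euclidean_space) \<ge> 3" and v: "v > 0"
  defines "a \<equiv> real DIM('a) / 2 - 1"
  shows "(\<integral>z. gauss_dens z 1 * (m_H (t *\<^sub>R z + u) v) ^ n \<partial>(lborel :: 'a measure)) =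
     (2 powr (- a) / Gamma a * v powr (- a)) ^ n * (\<integral>x. tilt a (t\<^sup>2 / v) ((norm u)\<^sup>2 / (2 * v)) x \<partial>pow_conv a n)"
proof -
  have a: "a > 0" using d by (simp add: a_def)
  let ?N = "pow_conv a n"
  note FN = finite_on_pow_conv[OF a, of n]
  interpret N: finite_measure ?N by (rule finite_onD[OF FN])
  note [measurable_cong] = finite_onD(2)[OF FN]
  interpret P: pair_sigma_finite "lborel :: 'a measure" ?N ..
  define C where "C = (2 powr (- a) / Gamma a * v powr (- a)) ^ n"
  define \<tau> where "\<tau> = t\<^sup>2 / v"
  define r where "r = (norm u)\<^sup>2 / (2 * v)"
  have \<tau>: "\<tau> \<ge> 0" "r \<ge> 0" using v by (auto simp: \<tau>_def r_def)
  define e where "e z x = exp (- ((norm (t *\<^sub>R z + u))\<^sup>2 / (2 * v)) * x)" for z :: 'a and x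
  have [measurable]: "case_prod e \<in> borel_measurable (borel \<Otimes>\<^sub>M borel)" unfolding e_def by measurable
  have e0: "e z x \<ge> 0" for z x by (simp add: e_def)
  have ie: "integrable ?N (e z)" for z
    unfolding e_def by (rule pow_conv_integrable[OF a]) (use v in \<open>auto intro!: continuous_intros\<close>)
  have it: "integrable ?N (tilt a \<tau> r)"
    by (rule pow_conv_integrable[OF a]) (auto intro!: tilt_cont[OF a \<tau>])
  have "(\<integral>\<^sup>+z. ennreal (gauss_dens z 1 * (\<integral>x. e z x \<partial>?N)) \<partial>lborel) = (\<integral>\<^sup>+z. (\<integral>\<^sup>+x. ennreal (gauss_dens z 1 * e z x) \<partial>?N) \<partial>lborel)"
  proof (rule nn_integral_cong)
    fix z :: 'a
    show "ennreal (gauss_dens z 1 * (\<integral>x. e z x \<partial>?N)) = (\<integral>\<^sup>+x. ennreal (gauss_dens z 1 * e z x) \<partial>?N)"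
      using ie[of z] by (subst nn_integral_eq_integral) (auto simp: gauss_dens_nonneg e0)
  qed
  also have "\<dots> = (\<integral>\<^sup>+x. (\<integral>\<^sup>+z. ennreal (gauss_dens z 1 * e z x) \<partial>lborel) \<partial>?N)"
    by (rule P.Fubini'[symmetric]) measurable
  also have "\<dots> = (\<integral>\<^sup>+x. ennreal (tilt a \<tau> r x) \<partial>?N)"
  proof (rule nn_integral_cong_AE)
    show "AE x in ?N. (\<integral>\<^sup>+z. ennreal (gauss_dens z 1 * e z x) \<partial>lborel) = ennreal (tilt a \<tau> r x)"
      using finite_onD(3)[OF FN]
    proof eventually_elim
      case (elim x)
      have x: "x / v \<ge> 0" using elim v by simp
      have "(\<integral>\<^sup>+z. ennreal (gauss_dens z 1 * e z x) \<partial>lborel) = (\<integral>\<^sup>+z. ennreal (gauss_dens z 1 * exp (- (x / v) * (norm (t *\<^sub>R z + u))\<^sup>2 / 2)) \<partial>lborel)"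
        by (simp add: e_def mult_ac)
      also have "\<dots> = ennreal ((1 + x / v * t\<^sup>2 * 1) powr (- real DIM('a) / 2) * exp (- (x / v) * (norm u)\<^sup>2 / (2 * (1 + x / v * t\<^sup>2 * 1))))"
        by (rule gauss_conv_exp[OF _ x]) simp
      also have "1 + x / v * t\<^sup>2 * 1 = 1 + \<tau> * x" by (simp add: \<tau>_def)
      also have "- real DIM('a) / 2 = - (a + 1)" by (simp add: a_def)
      also have "- (x / v) * (norm u)\<^sup>2 / (2 * (1 + \<tau> * x)) = - r * (x / (1 + \<tau> * x))"
        unfolding r_def by (simp add: divide_divide_eq_left divide_divide_eq_right mult.commute mult.left_commute del: distrib_left_numeral)
      finally show ?case by (simp add: tilt_def)
    qed
  qed
  also have "\<dots> = ennreal (\<integral>x. tilt a \<tau> r x \<partial>?N)"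
    by (rule nn_integral_eq_integral[OF it]) (simp add: tilt_def)
  finally have nn: "(\<integral>\<^sup>+z. ennreal (gauss_dens z 1 * (\<integral>x. e z x \<partial>?N)) \<partial>lborel) = ennreal (\<integral>x. tilt a \<tau> r x \<partial>?N)" .
  have "m_H (t *\<^sub>R z + u) v ^ n = C * (\<integral>x. e z x \<partial>?N)" for z
    unfolding m_H_mixture[OF d v] a_def[symmetric] power_mult_distrib exp_pow_measure_power[OF a] C_def e_def ..
  then have "(\<integral>z. gauss_dens z 1 * (m_H (t *\<^sub>R z + u) v) ^ n \<partial>(lborel :: 'a measure)) = (\<integral>z. C * (gauss_dens z 1 * (\<integral>x. e z x \<partial>?N)) \<partial>lborel)"
    by (simp add: mult_ac)
  also have "\<dots> = C * (\<integral>z. gauss_dens z 1 * (\<integral>x. e z x \<partial>?N) \<partial>lborel)"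
    by (rule integral_mult_right_zero)
  also have "(\<integral>z. gauss_dens z 1 * (\<integral>x. e z x \<partial>?N) \<partial>lborel) = enn2real (\<integral>\<^sup>+z. ennreal (gauss_dens z 1 * (\<integral>x. e z x \<partial>?N)) \<partial>lborel)"
    by (rule integral_eq_nn_integral) (auto simp: gauss_dens_nonneg e0)
  also have "\<dots> = (\<integral>x. tilt a \<tau> r x \<partial>?N)"
    unfolding nn by (rule enn2real_ennreal) (auto simp: tilt_def)
  finally show ?thesis by (simp add: C_def \<tau>_def r_def)
qed

section \<open>Differentiation in r and the Laplacian of a radial function\<close>

text \<open>Everything follows from exp s \<ge> 1 + s, used at y and at -y.\<close>

lemma exp_second_order_bound: "\<bar>exp y - 1 - y\<bar> \<le> y\<^sup>2 * exp \<bar>y\<bar>" for y :: real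
proof -
  have 1: "exp y - 1 - y \<ge> 0" using exp_ge_add_one_self[of y] by linarith
  have "1 - y \<le> exp (- y)" using exp_ge_add_one_self[of "-y"] by simp
  then have "exp y * (1 - y) \<le> exp y * exp (- y)" by (intro mult_left_mono) auto
  then have "exp y * (1 - y) \<le> 1" by (simp add: exp_minus_inverse)
  then have 2: "exp y - 1 - y \<le> y * (exp y - 1)" by (simp add: algebra_simps)
  have 3: "y * (exp y - 1) \<le> y\<^sup>2 * exp \<bar>y\<bar>"
  proof (cases "y \<ge> 0")
    case True
    have "exp y - 1 \<le> y * exp y" using \<open>exp y * (1 - y) \<le> 1\<close> by (simp add: algebra_simps)
    then have "y * (exp y - 1) \<le> y * (y * exp y)" using True by (intro mult_left_mono)
    then show ?thesis using True by (simp add: power2_eq_square mult.assoc)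
  next
    case False
    have "y * (exp y - 1) \<le> y * y" using False 1 by (intro mult_left_mono_neg) auto
    also have "\<dots> \<le> y * y * exp \<bar>y\<bar>" using mult_left_mono[of 1 "exp \<bar>y\<bar>" "y * y"] by simp
    finally show ?thesis by (simp add: power2_eq_square)
  qed
  show ?thesis using 1 2 3 by simp
qed

text \<open>As \<open>l\<close> is bounded on [0, b], the second-order remainder is uniform in x and
  the difference quotient has an error of order \<delta>. The factor \<open>h\<close> lets the lemma
  be iterated, since a derivative has the same form with \<open>l * h\<close> for
  \<open>h\<close>.\<close>

lemma laplace_transform_deriv:
  fixes h l :: "real \<Rightarrow> real"
  assumes N: "finite_on b N"
    and [measurable]: "h \<in> borel_measurable borel" "l \<in> borel_measurable borel"
    and ch: "continuous_on {0..b} h" and cl: "continuous_on {0..b} l"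
  shows "((\<lambda>r. \<integral>x. h x * exp (- r * l x) \<partial>N) has_real_derivative - (\<integral>x. l x * h x * exp (- r * l x) \<partial>N)) (at r)"
proof -
  obtain B where B: "\<And>x. 0 \<le> x \<Longrightarrow> x \<le> b \<Longrightarrow> \<bar>l x\<bar> \<le> B" using continuous_bound_Icc[OF cl] by blast
  note intg = finite_on_integrable_cont[OF N]
  have i0: "integrable N (\<lambda>x. h x * exp (- s * l x))" for s
    by (auto intro!: intg continuous_intros ch cl)
  have i1: "integrable N (\<lambda>x. l x * h x * exp (- r * l x))"
    by (auto intro!: intg continuous_intros ch cl)
  have i2: "integrable N (\<lambda>x. \<bar>h x\<bar> * exp (- r * l x))"
    by (auto intro!: intg continuous_intros ch cl)
  define c where "c = (\<integral>x. \<bar>h x\<bar> * exp (- r * l x) \<partial>N)"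
  let ?F = "\<lambda>r. \<integral>x. h x * exp (- r * l x) \<partial>N" and ?D = "- (\<integral>x. l x * h x * exp (- r * l x) \<partial>N)"
  have bd: "\<bar>?F (r + \<delta>) - ?F r - \<delta> * ?D\<bar> \<le> \<delta>\<^sup>2 * (B\<^sup>2 * exp (\<bar>\<delta>\<bar> * B) * c)" for \<delta>
  proof -
    define K where "K = \<delta>\<^sup>2 * B\<^sup>2 * exp (\<bar>\<delta>\<bar> * B)"
    define g where "g x = h x * exp (- (r + \<delta>) * l x) - h x * exp (- r * l x) + \<delta> * (l x * h x * exp (- r * l x))" for x
    have ig: "integrable N g"
      unfolding g_def
      by (rule Bochner_Integration.integrable_add[OF Bochner_Integration.integrable_diff[OF i0 i0] integrable_mult_right[OF i1]])
    have "(\<integral>x. g x \<partial>N) = ?F (r + \<delta>) - ?F r + \<delta> * (\<integral>x. l x * h x * exp (- r * l x) \<partial>N)"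
      unfolding g_def
      using Bochner_Integration.integral_add[OF Bochner_Integration.integrable_diff[OF i0[of "r + \<delta>"] i0[of r]] integrable_mult_right[OF i1, of \<delta>]]
        Bochner_Integration.integral_diff[OF i0[of "r + \<delta>"] i0[of r]] integral_mult_right_zero[of N \<delta> "\<lambda>x. l x * h x * exp (- r * l x)"]
      by linarith
    then have "?F (r + \<delta>) - ?F r - \<delta> * ?D = (\<integral>x. g x \<partial>N)" by linarith
    also have "\<bar>\<dots>\<bar> \<le> (\<integral>x. \<bar>g x\<bar> \<partial>N)" by (rule integral_abs_bound)
    also have "\<dots> \<le> (\<integral>x. K * (\<bar>h x\<bar> * exp (- r * l x)) \<partial>N)"
    proof (rule integral_mono_AE[OF integrable_abs[OF ig] integrable_mult_right[OF i2]])
      show "AE x in N. \<bar>g x\<bar> \<le> K * (\<bar>h x\<bar> * exp (- r * l x))"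
        using finite_onD(3)[OF N]
      proof eventually_elim
        case (elim x)
        \<comment> \<open>With this increment of the exponent, the integrand of the error is (exp y
          - 1 - y) times the original integrand.\<close>
        define y where "y = - \<delta> * l x"
        have gen: "H * (P * E) - H * P + d * (L * H * P) = (E - 1 - - d * L) * (H * P)" for H P E d L :: real
          by (simp add: algebra_simps)
        have E: "exp (- (r + \<delta>) * l x) = exp (- r * l x) * exp y"
          unfolding y_def exp_add[symmetric] by (simp add: algebra_simps)
        have "g x = (exp y - 1 - y) * (h x * exp (- r * l x))"
          unfolding g_def E unfolding y_def by (rule gen)
        then have "\<bar>g x\<bar> = \<bar>exp y - 1 - y\<bar> * (\<bar>h x\<bar> * exp (- r * l x))"
          by (simp only: abs_mult abs_exp_cancel)
        also have "\<dots> \<le> K * (\<bar>h x\<bar> * exp (- r * l x))"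
        proof (rule mult_right_mono)
          have "\<bar>l x\<bar> \<le> B" using B elim by auto
          then have y: "\<bar>y\<bar> \<le> \<bar>\<delta>\<bar> * B" unfolding y_def by (simp add: abs_mult mult_left_mono)
          then have "y\<^sup>2 \<le> \<delta>\<^sup>2 * B\<^sup>2"
            using power_mono[OF y, of 2] by (simp add: power_mult_distrib)
          with y have "y\<^sup>2 * exp \<bar>y\<bar> \<le> K" unfolding K_def by (intro mult_mono) auto
          with exp_second_order_bound[of y] show "\<bar>exp y - 1 - y\<bar> \<le> K" by linarith
        qed simp
        finally show ?case .
      qed
    qed
    also have "\<dots> = K * c" unfolding c_def by (rule integral_mult_right_zero)
    finally show ?thesis by (simp only: K_def mult.assoc)
  qed
  show ?thesis
    unfolding DERIV_def
  proof (rule LIM_zero_cancel)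
    show "((\<lambda>\<delta>. (?F (r + \<delta>) - ?F r) / \<delta> - ?D) \<longlongrightarrow> 0) (at 0)"
    proof (rule Lim_null_comparison)
      show "\<forall>\<^sub>F \<delta> in at 0. norm ((?F (r + \<delta>) - ?F r) / \<delta> - ?D) \<le> \<bar>\<delta>\<bar> * (B\<^sup>2 * exp (\<bar>\<delta>\<bar> * B) * c)"
        unfolding eventually_at_filter
      proof (intro always_eventually allI impI)
        fix \<delta> :: real assume "\<delta> \<noteq> 0"
        then have quot: "X / \<delta> - D = (X - \<delta> * D) / \<delta>" "\<delta>\<^sup>2 * X / \<bar>\<delta>\<bar> = \<bar>\<delta>\<bar> * X" for X D
          by (auto simp: field_simps power2_eq_square abs_if)
        from quot(1) have "norm ((?F (r + \<delta>) - ?F r) / \<delta> - ?D) = \<bar>?F (r + \<delta>) - ?F r - \<delta> * ?D\<bar> / \<bar>\<delta>\<bar>" by (simp only: real_norm_def abs_divide)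
        also have "\<dots> \<le> \<delta>\<^sup>2 * (B\<^sup>2 * exp (\<bar>\<delta>\<bar> * B) * c) / \<bar>\<delta>\<bar>" by (intro divide_right_mono bd) simp
        also have "\<dots> = \<bar>\<delta>\<bar> * (B\<^sup>2 * exp (\<bar>\<delta>\<bar> * B) * c)"
          by (rule quot(2))
        finally show "norm ((?F (r + \<delta>) - ?F r) / \<delta> - ?D) \<le> \<bar>\<delta>\<bar> * (B\<^sup>2 * exp (\<bar>\<delta>\<bar> * B) * c)" .
      qed
      show "((\<lambda>\<delta>. \<bar>\<delta>\<bar> * (B\<^sup>2 * exp (\<bar>\<delta>\<bar> * B) * c)) \<longlongrightarrow> 0) (at 0)"
      proof -
        have "isCont (\<lambda>\<delta>. \<bar>\<delta>\<bar> * (B\<^sup>2 * exp (\<bar>\<delta>\<bar> * B) * c)) 0" by (intro continuous_intros)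
        then show ?thesis unfolding isCont_def by simp
      qed
    qed
  qed
qed

text \<open>Along a basis direction the argument of G is a quadratic in s with slope (u . i)/v at 0
  and second derivative 1/v. Summing over the basis turns the squared slopes into |u|^2 / v^2 = 2R/v
  and the second derivatives into d/v.\<close>

lemma laplacian_radial:
  fixes G G' G'' :: "real \<Rightarrow> real" and u :: "'a::euclidean_space"
  assumes G: "\<And>r. (G has_real_derivative G' r) (at r)" and G': "\<And>r. (G' has_real_derivative G'' r) (at r)"
    and v: "v > 0"
  defines "R \<equiv> (norm u)\<^sup>2 / (2 * v)"
  shows "laplacian (\<lambda>u. G ((norm u)\<^sup>2 / (2 * v))) u = (2 * R * G'' R + real DIM('a) * G' R) / v"
proof -
  have "deriv (deriv (\<lambda>s. G ((norm (u + s *\<^sub>R i))\<^sup>2 / (2 * v)))) 0 = (u \<bullet> i)\<^sup>2 / v\<^sup>2 * G'' R + G' R / v"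
    if i: "i \<in> Basis" for i
  proof -
    define q where "q s = ((norm u)\<^sup>2 + 2 * s * (u \<bullet> i) + s\<^sup>2) / (2 * v)" for s
    have q: "(norm (u + s *\<^sub>R i))\<^sup>2 / (2 * v) = q s" for s
      unfolding q_def power2_norm_eq_inner using i
      by (simp add: inner_add_left inner_add_right inner_commute power2_eq_square algebra_simps)
    have dq: "(q has_real_derivative ((u \<bullet> i) + s) / v) (at s)" for s
      unfolding q_def using v by (auto intro!: derivative_eq_intros simp: field_simps)
    have q0: "q 0 = R" by (simp add: q_def R_def)
    \<comment> \<open>The outer \<open>deriv\<close> acts on the inner one as a function, so the
      first derivative is identified for every s, not just at 0.\<close>
    have d1: "deriv (\<lambda>s. G (q s)) = (\<lambda>s. G' (q s) * (((u \<bullet> i) + s) / v))"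
      by (rule ext, rule DERIV_imp_deriv, rule DERIV_chain2[OF G dq])
    have "((\<lambda>s. G' (q s) * (((u \<bullet> i) + s) / v)) has_real_derivative
        (G'' (q 0) * (((u \<bullet> i) + 0) / v)) * (((u \<bullet> i) + 0) / v) + (1 / v) * G' (q 0)) (at 0)"
      by (rule DERIV_mult[OF DERIV_chain2[OF G' dq]]) (use v in \<open>auto intro!: derivative_eq_intros\<close>)
    from DERIV_imp_deriv[OF this] have "deriv (deriv (\<lambda>s. G (q s))) 0 = (u \<bullet> i)\<^sup>2 / v\<^sup>2 * G'' R + G' R / v"
      unfolding d1 q0 by (simp add: power2_eq_square mult_ac)
    then show ?thesis unfolding q .
  qed
  then have "laplacian (\<lambda>u. G ((norm u)\<^sup>2 / (2 * v))) u = (\<Sum>i\<in>Basis. (u \<bullet> i)\<^sup>2 / v\<^sup>2 * G'' R + G' R / v)"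
    unfolding laplacian_def by simp
  also have "\<dots> = (norm u)\<^sup>2 / v\<^sup>2 * G'' R + real DIM('a) * (G' R / v)"
  proof -
    have "(norm u)\<^sup>2 = (\<Sum>i\<in>Basis. (u \<bullet> i)\<^sup>2)"
      unfolding power2_norm_eq_inner euclidean_inner[of u u] by (simp add: power2_eq_square)
    then show ?thesis
      by (simp only:) (simp add: sum.distrib sum_distrib_right[symmetric] sum_divide_distrib[symmetric])
  qed
  also have "\<dots> = (2 * R * G'' R + real DIM('a) * G' R) / v"
    unfolding R_def using v by (simp add: field_simps power2_eq_square)
  finally show ?thesis .
qed

section \<open>Superharmonicity from the variance inequality\<close>

theorem theorem4:
  fixes v c t :: real and \<nu> :: nat
  assumes "DIM('a::euclidean_space) \<ge> 3"
    and "v > 0" and "0 < c" and "c < 1" and "\<nu> \<ge> 2"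
    and "0 \<le> t"
    and "t \<le> sqrt (((real DIM('a) + 2) * (1 - c) * v) / (real DIM('a) * real \<nu> * (real \<nu> - 1)))"
  shows "\<forall>u::'a. laplacian
           (\<lambda>u. (\<integral>z. gauss_dens z 1 * (m_H (t *\<^sub>R z + u) v) ^ \<nu> \<partial>(lborel :: 'a measure))
                 powr (c / real \<nu>)) u \<le> 0"
proof
  fix u :: 'a
  note v = \<open>v > 0\<close>
  define a where "a = real DIM('a) / 2 - 1"
  have a: "a > 0" using assms(1) by (simp add: a_def)
  define \<tau> where "\<tau> = t\<^sup>2 / v"
  have \<tau>: "\<tau> \<ge> 0" using v by (simp add: \<tau>_def)
  \<comment> \<open>The hypothesis on t squared and divided by v, using d = 2 (a + 1) and d + 2 = 2
    (a + 2).\<close>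
  have \<tau>le: "(real \<nu> - 1) * \<tau> * (real \<nu> * (a + 1) / (a + 2)) \<le> 1 - c"
  proof -
    let ?X = "((real DIM('a) + 2) * (1 - c) * v) / (real DIM('a) * real \<nu> * (real \<nu> - 1))"
    have X: "?X \<ge> 0" using assms by simp
    have d: "real DIM('a) > 0" "real \<nu> > 0" "real \<nu> - 1 > 0" using assms by auto
    have "t\<^sup>2 \<le> (sqrt ?X)\<^sup>2" using assms by (intro power_mono) auto
    then have "t\<^sup>2 \<le> ?X" using X by simp
    then have "t\<^sup>2 * (real DIM('a) * real \<nu> * (real \<nu> - 1)) \<le> (real DIM('a) + 2) * (1 - c) * v"
      using d by (simp add: pos_le_divide_eq)
    then have "(real \<nu> - 1) * t\<^sup>2 * (real \<nu> * real DIM('a)) \<le> (1 - c) * ((real DIM('a) + 2) * v)"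
      by (simp add: mult_ac)
    then have "(real \<nu> - 1) * t\<^sup>2 * (real \<nu> * real DIM('a)) / ((real DIM('a) + 2) * v) \<le> 1 - c"
      using v by (simp add: pos_divide_le_eq)
    also have "(real \<nu> - 1) * t\<^sup>2 * (real \<nu> * real DIM('a)) / ((real DIM('a) + 2) * v) = (real \<nu> - 1) * \<tau> * (real \<nu> * (a + 1) / (a + 2))"
      unfolding \<tau>_def a_def using v d by (simp add: field_simps)
    finally show ?thesis .
  qed
  define N where "N = pow_conv a \<nu>"
  note FN = finite_on_pow_conv[OF a, of \<nu>, folded N_def]
  define C where "C = (2 powr (- a) / Gamma a * v powr (- a)) ^ \<nu>"
  have C: "C > 0" using a v by (simp add: C_def Gamma_real_pos)
  define h where "h x = (1 + \<tau> * x) powr (- (a + 1))" for x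
  define l where "l x = x / (1 + \<tau> * x)" for x
  have [measurable]: "h \<in> borel_measurable borel" "l \<in> borel_measurable borel"
    unfolding h_def l_def by measurable
  have pz: "1 + \<tau> * x \<noteq> 0" if "x \<ge> 0" for x
    using one_plus_nz[OF \<tau> that] .
  have ch: "continuous_on {0..real \<nu>} h" unfolding h_def using pz by (intro continuous_intros) auto
  have cl: "continuous_on {0..real \<nu>} l" unfolding l_def using pz by (intro continuous_intros) auto
  define \<Phi>0 where "\<Phi>0 r = (\<integral>x. h x * exp (- r * l x) \<partial>N)" for r
  define \<Phi>1 where "\<Phi>1 r = (\<integral>x. (l x * h x) * exp (- r * l x) \<partial>N)" for r
  define \<Phi>2 where "\<Phi>2 r = (\<integral>x. (l x * (l x * h x)) * exp (- r * l x) \<partial>N)" for r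
  have d0: "(\<Phi>0 has_real_derivative - \<Phi>1 r) (at r)" for r
    unfolding \<Phi>0_def \<Phi>1_def by (rule laplace_transform_deriv[OF FN]) (auto intro: ch cl)
  have d1: "(\<Phi>1 has_real_derivative - \<Phi>2 r) (at r)" for r
    unfolding \<Phi>1_def \<Phi>2_def by (rule laplace_transform_deriv[OF FN]) (auto intro!: ch cl continuous_intros)
  have tilt: "tilt a \<tau> r x = h x * exp (- r * l x)" for r x by (simp add: tilt_def h_def l_def)
  have pos: "\<Phi>0 r > 0" for r
  proof -
    have i: "integrable (pow_conv a \<nu>) (\<lambda>x. h x * exp (- r * l x))"
      by (auto intro!: pow_conv_integrable[OF a] continuous_intros ch cl)
    have "continuous_on {0..real \<nu>} (\<lambda>x. h x * exp (- r * l x))" by (intro continuous_intros ch cl)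
    then obtain y where y: "y \<in> {0..real \<nu>}" "\<And>x. x \<in> {0..real \<nu>} \<Longrightarrow> h y * exp (- r * l y) \<le> h x * exp (- r * l x)"
      using continuous_attains_inf[of "{0..real \<nu>}" "\<lambda>x. h x * exp (- r * l x)"] by auto
    have "h y * exp (- r * l y) > 0" using pz y by (simp add: h_def)
    then show ?thesis unfolding \<Phi>0_def N_def by (rule pow_conv_integral_pos[OF a i]) (use y in auto)
  qed
  define p where "p = c / real \<nu>"
  define G where "G r = (C * \<Phi>0 r) powr p" for r
  define G1 where "G1 r = - p * C * (\<Phi>1 r * (C * \<Phi>0 r) powr (p - 1))" for r
  define G2 where "G2 r = p * C * (\<Phi>2 r * (C * \<Phi>0 r) powr (p - 1) + (p - 1) * C * (\<Phi>1 r)\<^sup>2 * (C * \<Phi>0 r) powr (p - 2))" for r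
  have CP: "C * \<Phi>0 r > 0" for r using C pos by simp
  have dC: "((\<lambda>r. C * \<Phi>0 r) has_real_derivative - C * \<Phi>1 r) (at r)" for r
    by (rule DERIV_cong[OF DERIV_cmult[OF d0]]) simp
  have dp: "((\<lambda>r. (C * \<Phi>0 r) powr q) has_real_derivative q * (C * \<Phi>0 r) powr (q - 1) * (- C * \<Phi>1 r)) (at r)" for q r
    using DERIV_fun_powr[OF dC CP, of q r] by simp
  have DG: "(G has_real_derivative G1 r) (at r)" for r
    unfolding G_def G1_def by (rule DERIV_cong[OF dp]) simp
  have DG1: "(G1 has_real_derivative G2 r) (at r)" for r
    unfolding G1_def G2_def
    by (rule DERIV_cong[OF DERIV_cmult[OF DERIV_mult[OF d1 dp]]]) (simp add: algebra_simps power2_eq_square)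
  define R where "R = (norm u)\<^sup>2 / (2 * v)"
  have R: "R \<ge> 0" using v by (simp add: R_def)
  have "(\<lambda>u::'a. (\<integral>z. gauss_dens z 1 * (m_H (t *\<^sub>R z + u) v) ^ \<nu> \<partial>(lborel :: 'a measure)) powr (c / real \<nu>))
      = (\<lambda>u. G ((norm u)\<^sup>2 / (2 * v)))"
    unfolding gauss_mean_m_H_power[OF assms(1) v] a_def[symmetric] C_def[symmetric] \<tau>_def[symmetric] N_def[symmetric]
      tilt G_def \<Phi>0_def p_def ..
  then have "laplacian (\<lambda>u::'a. (\<integral>z. gauss_dens z 1 * (m_H (t *\<^sub>R z + u) v) ^ \<nu> \<partial>(lborel :: 'a measure)) powr (c / real \<nu>)) u
     = (2 * R * G2 R + real DIM('a) * G1 R) / v"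
    using laplacian_radial[OF DG DG1 v, of u] unfolding R_def by simp
  also have "2 * R * G2 R + real DIM('a) * G1 R \<le> 0"
  proof -
    have da: "real DIM('a) = 2 * (a + 1)" by (simp add: a_def)
    have T: "\<Phi>0 R * (R * \<Phi>2 R - (a + 1) * \<Phi>1 R) \<le> (1 - p) * R * (\<Phi>1 R)\<^sup>2"
      using tilt_variance_bound[OF a \<tau> R assms(5,3,4) \<tau>le]
      unfolding N_def[symmetric] tilt l_def[symmetric] p_def[symmetric] \<Phi>0_def \<Phi>1_def \<Phi>2_def
      by (simp add: power2_eq_square mult_ac)
    \<comment> \<open>Pulling out this common positive power leaves an expression quadratic in the
      integrals, whose sign is given by \<open>tilt_variance_bound\<close>.\<close>
    define Q where "Q = (C * \<Phi>0 R) powr (p - 2)"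
    have Q: "Q > 0" using C pos[of R] by (simp add: Q_def)
    have Q1: "(C * \<Phi>0 R) powr (p - 1) = C * \<Phi>0 R * Q"
    proof -
      have "(C * \<Phi>0 R) powr (p - 1) = (C * \<Phi>0 R) powr (1 + (p - 2))" by simp
      also have "\<dots> = C * \<Phi>0 R * Q" unfolding powr_add Q_def using CP[of R] by simp
      finally show ?thesis .
    qed
    have "2 * R * G2 R + real DIM('a) * G1 R = 2 * p * C * C * Q * (\<Phi>0 R * (R * \<Phi>2 R - (a + 1) * \<Phi>1 R) - (1 - p) * R * (\<Phi>1 R)\<^sup>2)"
      unfolding G1_def G2_def Q1 Q_def[symmetric] da by (simp add: algebra_simps power2_eq_square)
    also have "\<dots> \<le> 0"
      using T C Q assms(3) by (intro mult_nonneg_nonpos) (auto simp: p_def)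
    finally show ?thesis .
  qed
  then have "(2 * R * G2 R + real DIM('a) * G1 R) / v \<le> 0" using v by (simp add: divide_nonpos_pos)
  finally show "laplacian (\<lambda>u. (\<integral>z. gauss_dens z 1 * (m_H (t *\<^sub>R z + u) v) ^ \<nu> \<partial>(lborel :: 'a measure)) powr (c / real \<nu>)) u \<le> 0" .
qed

end
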